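(* Let $p^{(5)}(n)$ denote the $5$-core partition function, i.e. $\sum_{n\ge 0}p^{(5)}(n)q^n=\prod_{n\ge1}\frac{(1-q^{5n})^5}{1-q^n}$. Then $$ C^{(5)}(z,\tau) := \prod_{n=1}^\infty\frac{(1-q^n)(1-q^{5n})(1-\zeta^{\pm2}q^{5n})(1-\zeta^{\pm 4}q^{5n})}{(1-\zeta^{\pm1}q^n)} $$ is a crank generating function for $p^{(5)}(n)$ which explains the congruences $p^{(5)}(15n+\beta)\equiv 0 \pmod 3$ (for all $n\ge 0$), where $\beta\in\{6,10,12,13\}$. That is: setting $\zeta=1$ in $C^{(5)}(z,\tau)$ gives $\sum_{n\ge0}p^{(5)}(n)q^n$, and for every $\beta\in\{6,10,12,13\}$ and every integer $n\ge 0$, the polynomial $\Phi_3(\zeta)=1+\zeta+\zeta^2$ divides $[q^{15n+\beta}]\,C^{(5)}(z,\tau)$ in $\mathbb{Z}[\zeta,\zeta^{-1}]$.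
   Context: Here $q=e^{2\pi i\tau}$ and $\zeta=e^{2\pi i z}$; $q$ and $\zeta$ may be treated as formal variables, and products are expanded as power series in $q$ with coefficients in $\mathbb{Z}[\zeta,\zeta^{-1}]$. Setting $z=0$ means setting $\zeta=1$. The shorthand $(1-\zeta^{\pm k}q^n)$ means $(1-\zeta^{k}q^n)(1-\zeta^{-k}q^n)$. The notation $[q^m]C(z,\tau)$ denotes the coefficient of $q^m$ in $C(z,\tau)$, a Laurent polynomial in $\zeta$. $\Phi_\ell$ denotes the $\ell$-th cyclotomic polynomial. Definition: given a generating function $\sum_{n\ge0}a(n)q^n$ satisfying $a(\alpha n+\beta)\equiv 0\pmod \ell$ for all $n\ge 0$, with $\alpha,\beta$ positive integers and $\ell$ a prime, a series $C(z,\tau)$ in $q$ with coefficients in $\mathbb{Z}[\zeta,\zeta^{-1}]$ is said to explain the congruence if and only if $C(0,\tau)=\sum_{n\ge0}a(n)q^n$ and $\Phi_\ell(\zeta)\mid[q^{\alpha n+\beta}]C(z,\tau)$ for all $n\ge0$. A series that explains at least one such congruence is called a crank generating function. *)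

theory Defs
  imports
    "HOL-Analysis.Infinite_Products"
    "HOL-Computational_Algebra.Computational_Algebra"
    "HOL-Library.Poly_Mapping"
    "HOL-Number_Theory.Cong"
begin

unbundle no vec_syntax
unbundle fps_syntax

section \<open>Laurent polynomials and power series over them\<close>

text \<open>The ring of Laurent polynomials in \<open>\<zeta>\<close> over the integers is the group ring of the additive
  group of integers: the coefficient of \<open>\<zeta>\<^sup>k\<close> in \<open>p\<close> is \<open>lookup p k\<close>, and multiplication on
  \<open>poly_mapping\<close> is convolution.\<close>

type_synonym int_laurent = "int \<Rightarrow>\<^sub>0 int"

definition zeta_pow :: "int \<Rightarrow> int_laurent" where
  "zeta_pow k = Poly_Mapping.single k 1"

definition laurent_at_one :: "int_laurent \<Rightarrow> int" where
  "laurent_at_one p = (\<Sum>k\<in>Poly_Mapping.keys p. Poly_Mapping.lookup p k)"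

definition set_zeta_one :: "int_laurent fps \<Rightarrow> int fps" where
  "set_zeta_one C = Abs_fps (\<lambda>n. laurent_at_one (C $ n))"

definition laurent_of_poly :: "int poly \<Rightarrow> int_laurent" where
  "laurent_of_poly p = poly (map_poly of_int p) (zeta_pow 1)"

text \<open>The coefficient rings here are not fields, so the division on \<open>fps\<close> is unavailable; this is
  the multiplicative inverse of a series with constant coefficient 1.\<close>

definition fps_recip :: "'a::comm_ring_1 fps \<Rightarrow> 'a fps" where
  "fps_recip f = fps_right_inverse f 1"

lemma fps_recip_mult:
  fixes f :: "'a::comm_ring_1 fps"
  assumes "f $ 0 = 1"
  shows "f * fps_recip f = 1"
  unfolding fps_recip_def by (rule fps_right_inverse) (use assms in simp)

text \<open>The following shows that the infinite products below converge (in the metric topology of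
  \<open>fps\<close>), so that \<open>prodinf\<close> denotes the intended series.\<close>

lemma fps_has_prodI:
  fixes f :: "nat \<Rightarrow> 'a::idom fps"
  assumes f0: "\<And>n. f n $ 0 = 1" and fk: "\<And>n k. 0 < k \<Longrightarrow> k \<le> n \<Longrightarrow> f n $ k = 0"
  shows "f has_prod Abs_fps (\<lambda>m. (\<Prod>i\<le>m. f i) $ m)"
proof -
  have stable: "(\<Prod>i\<le>N. f i) $ m = (\<Prod>i\<le>m. f i) $ m" if "m \<le> N" for m N
    using that
  proof (induction N rule: dec_induct)
    case base
    show ?case by simp
  next
    case (step N)
    have "((\<Prod>i\<le>N. f i) * f (Suc N)) $ m = (\<Sum>i=0..m. (\<Prod>i\<le>N. f i) $ i * f (Suc N) $ (m - i))"
      by (simp add: fps_mult_nth)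
    also have "\<dots> = (\<Sum>i=0..m. if i = m then (\<Prod>i\<le>N. f i) $ i else 0)"
      by (rule sum.cong) (use step.hyps in \<open>auto simp: f0 fk\<close>)
    also have "\<dots> = (\<Prod>i\<le>N. f i) $ m"
      by simp
    finally show ?case using step.IH by (simp add: mult.commute)
  qed
  have "(\<lambda>n. \<Prod>i\<le>n. f i) \<longlonglongrightarrow> Abs_fps (\<lambda>m. (\<Prod>i\<le>m. f i) $ m)"
  proof (rule tendsto_fpsI)
    fix m
    show "\<forall>\<^sub>F n in sequentially. (\<Prod>i\<le>n. f i) $ m = Abs_fps (\<lambda>m. (\<Prod>i\<le>m. f i) $ m) $ m"
      using eventually_ge_at_top[of m] unfolding fps_nth_Abs_fps
      by eventually_elim (rule stable)
  qed
  moreover have "Abs_fps (\<lambda>m. (\<Prod>i\<le>m. f i) $ m) \<noteq> 0"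
  proof
    assume "Abs_fps (\<lambda>m. (\<Prod>i\<le>m. f i) $ m) = 0"
    hence "Abs_fps (\<lambda>m. (\<Prod>i\<le>m. f i) $ m) $ 0 = 0" by (simp only: fps_zero_nth)
    thus False by (simp add: f0)
  qed
  ultimately show ?thesis
    by (simp add: has_prod_def raw_has_prod_def)
qed

section \<open>Cyclotomic polynomials\<close>

definition cyclotomic_complex :: "nat \<Rightarrow> complex poly" where
  "cyclotomic_complex m =
     (\<Prod>k\<in>{k\<in>{1..m}. coprime k m}. [:- cis (2 * pi * real k / real m), 1:])"

definition cyclotomic :: "nat \<Rightarrow> int poly" where
  "cyclotomic m = (THE p. map_poly of_int p = cyclotomic_complex m)"

lemma cyclotomic_3: "cyclotomic 3 = [:1, 1, 1:]"
proof -
  have S: "{k\<in>{1..3}. coprime k (3::nat)} = {1, 2}"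
  proof -
    have "{1..3::nat} = {1, 2, 3}" by auto
    moreover have "coprime 2 (3::nat)" using coprime_Suc_right_nat[of 2] by (simp only: numeral_3_eq_3 numeral_2_eq_2)
    ultimately show ?thesis by auto
  qed
  have c1: "cis (2 * pi / 3) = Complex (-1/2) (sqrt 3 / 2)"
    by (simp add: cis.ctr cos_120 sin_120)
  have c2: "cis (2 * pi * 2 / 3) = cis (2 * pi / 3) ^ 2"
    by (simp only: Complex.DeMoivre) (simp add: field_simps)
  have c2': "cis (2 * pi / 3) ^ 2 = Complex (-1/2) (-sqrt 3 / 2)"
    unfolding c1 by (simp add: power2_eq_square complex_eq_iff)
  have "cyclotomic_complex 3 = [:- cis (2 * pi / 3), 1:] * [:- cis (2 * pi * 2 / 3), 1:]"
    unfolding cyclotomic_complex_def S by simp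
  also have "\<dots> = [:1, 1, 1:]"
    unfolding c2 c2' unfolding c1 by (simp add: complex_eq_iff)
  finally have "cyclotomic_complex 3 = [:1, 1, 1:]" .
  hence *: "map_poly of_int [:1, 1, 1:] = cyclotomic_complex 3"
    by (simp add: map_poly_pCons)
  show ?thesis unfolding cyclotomic_def
  proof (rule the_equality)
    show "map_poly of_int [:1, 1, 1:] = cyclotomic_complex 3" by (fact *)
  next
    fix p :: "int poly"
    assume "map_poly of_int p = cyclotomic_complex 3"
    with * have "map_poly (of_int :: int \<Rightarrow> complex) p = map_poly of_int [:1, 1, 1:]" by simp
    hence "coeff (map_poly (of_int :: int \<Rightarrow> complex) p) i = coeff (map_poly of_int [:1, 1, 1:]) i" for i
      by simp
    thus "p = [:1, 1, 1:]"
      by (intro poly_eqI) (simp only: coeff_map_poly of_int_0 of_int_eq_iff)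
  qed
qed

section \<open>Crank generating functions\<close>

text \<open>\<open>explains C a \<alpha> \<beta> l\<close>: the sequence \<open>a\<close> satisfies the congruence \<open>a(\<alpha>n+\<beta>) \<equiv> 0 (mod l)\<close> for all
  \<open>n\<close>, and \<open>C\<close> explains it. The variable of \<open>C\<close> as a power series is \<open>q\<close>; divisibility is in the
  ring of Laurent polynomials.\<close>

definition explains ::
    "int_laurent fps \<Rightarrow> (nat \<Rightarrow> int) \<Rightarrow> nat \<Rightarrow> nat \<Rightarrow> nat \<Rightarrow> bool" where
  "explains C a \<alpha> \<beta> l \<longleftrightarrow>
     \<alpha> > 0 \<and> \<beta> > 0 \<and> prime l \<and>
     (\<forall>n. [a (\<alpha> * n + \<beta>) = 0] (mod int l)) \<and>
     set_zeta_one C = Abs_fps a \<and>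
     (\<forall>n. laurent_of_poly (cyclotomic l) dvd C $ (\<alpha> * n + \<beta>))"

definition is_crank_gf :: "int_laurent fps \<Rightarrow> (nat \<Rightarrow> int) \<Rightarrow> bool" where
  "is_crank_gf C a \<longleftrightarrow> (\<exists>\<alpha> \<beta> l. explains C a \<alpha> \<beta> l)"

section \<open>The 5-core partition function and its crank\<close>

text \<open>Infinite products are limits in the \<open>q\<close>-adic topology of \<open>fps\<close>. Since \<open>prodinf\<close> starts at
  index 0, factor \<open>n\<close> is placed at index \<open>n - 1\<close>.\<close>

definition core5_factor :: "nat \<Rightarrow> int fps" where
  "core5_factor n = (1 - fps_X ^ (5 * n)) ^ 5 * fps_recip (1 - fps_X ^ n)"

definition core5 :: "nat \<Rightarrow> int" where
  "core5 m = prodinf (\<lambda>i. core5_factor (Suc i)) $ m"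

text \<open>\<open>lin k n\<close> is \<open>1 - \<zeta>\<^sup>k q\<^sup>n\<close>, and \<open>lin_pm k n\<close> is \<open>(1 - \<zeta>\<^sup>k q\<^sup>n)(1 - \<zeta>\<^sup>-\<^sup>k q\<^sup>n)\<close>.\<close>

definition lin :: "int \<Rightarrow> nat \<Rightarrow> int_laurent fps" where
  "lin k n = 1 - fps_const (zeta_pow k) * fps_X ^ n"

definition lin_pm :: "int \<Rightarrow> nat \<Rightarrow> int_laurent fps" where
  "lin_pm k n = lin k n * lin (- k) n"

definition C5_factor :: "nat \<Rightarrow> int_laurent fps" where
  "C5_factor n =
     (1 - fps_X ^ n) * (1 - fps_X ^ (5 * n)) * lin_pm 2 (5 * n) * lin_pm 4 (5 * n)
       * fps_recip (lin_pm 1 n)"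

definition C5 :: "int_laurent fps" where
  "C5 = prodinf (\<lambda>i. C5_factor (Suc i))"

text \<open>\<open>unit_upto n f\<close> is \<open>f \<equiv> 1\<close> modulo \<open>q\<^sup>n\<^sup>+\<^sup>1\<close>.\<close>

definition unit_upto :: "nat \<Rightarrow> 'a::comm_ring_1 fps \<Rightarrow> bool" where
  "unit_upto n f \<longleftrightarrow> (\<forall>k\<le>n. f $ k = 1 $ k)"

lemma unit_upto_mult:
  assumes "unit_upto n f" "unit_upto n g"
  shows "unit_upto n (f * g)"
  unfolding unit_upto_def
proof (intro allI impI)
  fix k assume "k \<le> n"
  hence "(f * g) $ k = (1 * 1 :: 'a fps) $ k"
    using assms unfolding fps_mult_nth unit_upto_def by (intro sum.cong) auto
  thus "(f * g) $ k = 1 $ k" by simp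
qed

lemma unit_upto_recip:
  assumes "unit_upto n f"
  shows "unit_upto n (fps_recip f)"
  unfolding unit_upto_def
proof (intro allI impI)
  fix k assume k: "k \<le> n"
  have "f $ 0 = 1" using assms by (simp add: unit_upto_def)
  hence "f * fps_recip f = 1" by (rule fps_recip_mult)
  moreover have "(f * fps_recip f) $ k = (1 * fps_recip f) $ k"
    unfolding fps_mult_nth
    by (rule sum.cong) (use assms k in \<open>auto simp: unit_upto_def\<close>)
  ultimately show "fps_recip f $ k = 1 $ k" by simp
qed

lemma unit_upto_power: "unit_upto n f \<Longrightarrow> unit_upto n (f ^ m)"
proof (induction m)
  case 0
  show ?case by (simp add: unit_upto_def)
next
  case (Suc m)
  thus ?case by (simp add: unit_upto_mult)
qed

lemma unit_upto_X: "n < m \<Longrightarrow> unit_upto n (1 - fps_X ^ m)"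
  by (auto simp: unit_upto_def fps_X_power_nth)

lemma unit_upto_lin_pm: "n < m \<Longrightarrow> unit_upto n (lin_pm k m)"
  unfolding lin_pm_def
  by (intro unit_upto_mult) (auto simp: unit_upto_def lin_def fps_X_power_nth)

lemma core5_has_prod:
  "(\<lambda>i. core5_factor (Suc i)) has_prod Abs_fps core5"
proof -
  have "unit_upto i (core5_factor (Suc i))" for i
    unfolding core5_factor_def
    by (intro unit_upto_mult unit_upto_power unit_upto_recip unit_upto_X) auto
  hence "(\<lambda>i. core5_factor (Suc i)) has_prod
      Abs_fps (\<lambda>m. (\<Prod>i\<le>m. core5_factor (Suc i)) $ m)"
    by (intro fps_has_prodI) (auto simp: unit_upto_def)
  moreover from has_prod_unique[OF this]
  have "Abs_fps core5 = Abs_fps (\<lambda>m. (\<Prod>i\<le>m. core5_factor (Suc i)) $ m)"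
    by (simp add: fps_eq_iff core5_def)
  ultimately show ?thesis by simp
qed

lemma C5_has_prod: "(\<lambda>i. C5_factor (Suc i)) has_prod C5"
proof -
  have "unit_upto i (C5_factor (Suc i))" for i
    unfolding C5_factor_def
    by (intro unit_upto_mult unit_upto_recip unit_upto_X unit_upto_lin_pm) auto
  hence "(\<lambda>i. C5_factor (Suc i)) has_prod
      Abs_fps (\<lambda>m. (\<Prod>i\<le>m. C5_factor (Suc i)) $ m)"
    by (intro fps_has_prodI) (auto simp: unit_upto_def)
  with has_prod_unique[OF this] show ?thesis by (simp add: C5_def)
qed

end

theory Submission
  imports Defs
begin

text \<open>
  Write \<open>f\<^sub>k\<close> for the product of \<open>1 - q\<^sup>k\<^sup>n\<close> over \<open>n \<ge> 1\<close>. Modulo \<open>\<Phi>\<^sub>3(\<zeta>)\<close> one has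
  \<open>\<zeta>\<^sup>k + \<zeta>\<^sup>-\<^sup>k = -1\<close> for \<open>k\<close> prime to 3, so every factor
  \<open>(1 - \<zeta>\<^sup>k q\<^sup>n)(1 - \<zeta>\<^sup>-\<^sup>k q\<^sup>n)\<close> of the crank becomes \<open>1 + q\<^sup>n + q\<^sup>2\<^sup>n\<close>, and the crank becomes
  the eta quotient \<open>f\<^sub>1\<^sup>2 f\<^sub>1\<^sub>5\<^sup>2 / (f\<^sub>3 f\<^sub>5)\<close>. Multiplied by \<open>q\<close>, this quotient is the Lambert series of
  \<open>\<chi>\<^sub>5(n) q\<^sup>n / (1 + q\<^sup>n + q\<^sup>2\<^sup>n)\<close>, whose coefficient at \<open>q\<^sup>N\<close> is the sum of
  \<open>\<chi>\<^sub>5(n) \<chi>\<^sub>3(N/n)\<close> over the divisors \<open>n\<close> of \<open>N\<close>. Exchanging \<open>n\<close> and \<open>N/n\<close> multiplies this sum by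
  \<open>\<chi>\<^sub>3(N) \<chi>\<^sub>5(N)\<close>; it therefore vanishes if \<open>N \<equiv> 7, 11, 13, 14 (mod 15)\<close>.

  The Lambert series comes from a partial fraction expansion in \<open>t = y + 1/y\<close>. The rational function
  with numerator the product of \<open>(1 - y\<^sup>2 q\<^sup>5\<^sup>k)(1 - y\<^sup>-\<^sup>2 q\<^sup>5\<^sup>k)\<close> over \<open>k \<le> M\<close> and denominator the product
  of \<open>(1 - y q\<^sup>n)(1 - y\<^sup>-\<^sup>1 q\<^sup>n)\<close> over \<open>n \<le> 5M\<close> with \<open>5\<close> not dividing \<open>n\<close> has simple poles at
  \<open>t = q\<^sup>n + q\<^sup>-\<^sup>n\<close>; as \<open>M\<close> grows its residues converge \<open>q\<close>-adically to \<open>\<chi>\<^sub>5(n) q\<^sup>n\<^sup>-\<^sup>1 / (f\<^sub>1 f\<^sub>5)\<close>.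
  A primitive cube root of unity \<open>y\<close> corresponds to \<open>t = -1\<close>, so no root of unity has to be adjoined.
\<close>

section \<open>Truncated power series identities\<close>

text \<open>Limits are replaced by agreement up to \<open>q\<^sup>d\<close>, so that the Lambert
  series identity involves finite products and sums only.\<close>

definition eq_upto :: "nat \<Rightarrow> 'a::comm_ring_1 fps \<Rightarrow> 'a fps \<Rightarrow> bool" where
  "eq_upto d f g \<longleftrightarrow> (\<forall>k\<le>d. f $ k = g $ k)"

lemma eq_upto_refl [simp]: "eq_upto d f f"
  by (simp add: eq_upto_def)

lemma eq_upto_sym: "eq_upto d f g \<Longrightarrow> eq_upto d g f"
  by (simp add: eq_upto_def)

lemma eq_upto_trans [trans]: "eq_upto d f g \<Longrightarrow> eq_upto d g h \<Longrightarrow> eq_upto d f h"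
  by (simp add: eq_upto_def)

lemma eq_upto_mult:
  "eq_upto d f f' \<Longrightarrow> eq_upto d g g' \<Longrightarrow> eq_upto d (f * g) (f' * g')"
  unfolding eq_upto_def fps_mult_nth by (intro allI impI sum.cong) auto

lemma eq_upto_sum:
  "(\<And>x. x \<in> A \<Longrightarrow> eq_upto d (f x) (g x)) \<Longrightarrow> eq_upto d (\<Sum>x\<in>A. f x) (\<Sum>x\<in>A. g x)"
  unfolding eq_upto_def by (auto simp: fps_sum_nth intro!: sum.cong)

lemma eq_upto_prod:
  "(\<And>x. x \<in> A \<Longrightarrow> eq_upto d (f x) (g x)) \<Longrightarrow> eq_upto d (\<Prod>x\<in>A. f x) (\<Prod>x\<in>A. g x)"
  by (induction A rule: infinite_finite_induct) (auto intro: eq_upto_mult)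

lemma eq_upto_prod_subset:
  assumes "finite B" "A \<subseteq> B" and "\<And>x. x \<in> B - A \<Longrightarrow> eq_upto d (f x) 1"
  shows "eq_upto d (\<Prod>x\<in>B. f x) (\<Prod>x\<in>A. f x)"
proof -
  have "(\<Prod>x\<in>B. f x) = (\<Prod>x\<in>B - A. f x) * (\<Prod>x\<in>A. f x)"
    using assms by (simp add: prod.subset_diff)
  moreover have "eq_upto d (\<Prod>x\<in>B - A. f x) 1"
    using eq_upto_prod[of "B - A" d f "\<lambda>_. 1"] assms(3) by simp
  ultimately show ?thesis
    using eq_upto_mult[of d "\<Prod>x\<in>B - A. f x" 1] by simp
qed

lemma eq_upto_cancel:
  assumes "eq_upto d (f * u) (g * u)" "u $ 0 = 1"
  shows "eq_upto d f g"
  using eq_upto_mult[OF assms(1) eq_upto_refl[of d "fps_recip u"]] fps_recip_mult[OF assms(2)]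
  by (simp add: mult.assoc)

lemma eq_upto_one_minus_X: "d < n \<Longrightarrow> eq_upto d (1 - fps_X ^ n) 1"
  by (auto simp: eq_upto_def fps_X_power_nth)

lemma fps_recip_unique:
  assumes "f $ 0 = 1" "f * g = 1"
  shows "g = fps_recip f"
  by (metis assms fps_recip_mult mult.left_commute mult.right_neutral)

lemma fps_prod_nth_0: "(\<Prod>x\<in>A. f x) $ 0 = (\<Prod>x\<in>A. (f x :: 'a::comm_ring_1 fps) $ 0)"
  by (induction A rule: infinite_finite_induct) auto

definition trinomial :: "nat \<Rightarrow> 'a::comm_ring_1 fps" where
  "trinomial n = 1 + fps_X ^ n + fps_X ^ (2 * n)"

lemma trinomial_nth_0: "n > 0 \<Longrightarrow> trinomial n $ 0 = 1"
  by (simp add: trinomial_def)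

section \<open>Partial fractions\<close>

text \<open>Both sides are polynomials in \<open>t\<close> of degree below \<open>card S\<close>
  that agree at the \<open>card S\<close> nodes. Divided by the product of all
  \<open>t - x m\<close>, this is a partial fraction expansion.\<close>

lemma lagrange_interpolation:
  fixes p :: "'k::field poly"
  assumes "finite S" "inj_on x S" "degree p < card S"
  shows "poly p t = (\<Sum>i\<in>S. poly p (x i) * (\<Prod>m\<in>S - {i}. (t - x m) / (x i - x m)))"
proof -
  define L where "L = (\<lambda>i. \<Prod>m\<in>S - {i}. [:- x m / (x i - x m), 1 / (x i - x m):])"
  define r where "r = (\<Sum>i\<in>S. smult (poly p (x i)) (L i))"
  have pL: "poly (L i) t = (\<Prod>m\<in>S - {i}. (t - x m) / (x i - x m))" for i t
    unfolding L_def poly_prod by (intro prod.cong) (auto simp: diff_divide_distrib)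
  have pr: "poly r t = (\<Sum>i\<in>S. poly p (x i) * (\<Prod>m\<in>S - {i}. (t - x m) / (x i - x m)))" for t
    by (simp add: r_def poly_sum pL)
  have "degree (L i) \<le> card S - 1" if "i \<in> S" for i
  proof -
    have "degree (L i) \<le> (\<Sum>m\<in>S - {i}. degree [:- x m / (x i - x m), 1 / (x i - x m):])"
      unfolding L_def by (rule degree_prod_sum_le[unfolded o_def]) (use assms in simp)
    also have "\<dots> \<le> (\<Sum>m\<in>S - {i}. 1)"
      by (intro sum_mono) simp
    finally show ?thesis using that assms by simp
  qed
  hence "degree r \<le> card S - 1"
    unfolding r_def by (intro degree_sum_le) (use assms in \<open>auto intro: order.trans[OF degree_smult_le]\<close>)
  moreover have "poly p y = poly r y" if "y \<in> x ` S" for y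
  proof -
    from that obtain j where j: "j \<in> S" "y = x j" by auto
    have *: "(\<Prod>m\<in>S - {i}. (x j - x m) / (x i - x m)) = (if i = j then 1 else 0)" if "i \<in> S" for i
    proof (cases "i = j")
      case True
      have "(\<Prod>m\<in>S - {i}. (x j - x m) / (x i - x m)) = (\<Prod>m\<in>S - {i}. 1)"
        by (rule prod.cong) (use True that assms(2) in \<open>auto simp: inj_on_eq_iff\<close>)
      thus ?thesis using True by simp
    next
      case False
      thus ?thesis using j assms by (auto intro!: prod_zero)
    qed
    show ?thesis unfolding pr j using assms j by (simp add: * if_distrib cong: if_cong)
  qed
  ultimately have "p = r"
    using assms by (intro poly_eqI_degree[of "x ` S"]) (auto simp: card_image)
  thus ?thesis using pr[of t] by simp
qed

text \<open>Raising n by 5 shifts k by 2 in \<open>2 * n - 5 * k\<close> and m by 5 in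
  \<open>n - m\<close>. This lemma and the next three peel off the terms that such a shift leaves
  over.\<close>

lemma sum_atLeast1_add2:
  fixes f :: "nat \<Rightarrow> 'a::comm_monoid_add"
  shows "sum f {1..n + 2} = f 1 + (f 2 + sum (\<lambda>k. f (k + 2)) {1..n})"
proof -
  have I: "{1..n + 2} = insert 1 (insert 2 {3..n + 2})"
    by auto
  have "sum f {1 + 2..n + 2} = sum (\<lambda>k. f (k + 2)) {1..n}"
    by (rule sum.shift_bounds_cl_nat_ivl)
  thus ?thesis
    unfolding I by (simp del: sum.cl_ivl_Suc add_2_eq_Suc')
qed

lemma prod_atLeast1_add2:
  fixes f :: "nat \<Rightarrow> 'a::comm_monoid_mult"
  shows "prod f {1..n + 2} = f 1 * (f 2 * prod (\<lambda>k. f (k + 2)) {1..n})"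
proof -
  have I: "{1..n + 2} = insert 1 (insert 2 {3..n + 2})"
    by auto
  have "prod f {1 + 2..n + 2} = prod (\<lambda>k. f (k + 2)) {1..n}"
    by (rule prod.shift_bounds_cl_nat_ivl)
  thus ?thesis
    unfolding I by (simp del: prod.cl_ivl_Suc add_2_eq_Suc')
qed

lemma sum_atLeast1_add5:
  fixes f :: "nat \<Rightarrow> 'a::comm_monoid_add"
  shows "sum f {1..n + 5} = f 1 + (f 2 + (f 3 + (f 4 + (f 5 + sum (\<lambda>k. f (k + 5)) {1..n}))))"
proof -
  have I: "{1..n + 5} = insert 1 (insert 2 (insert 3 (insert 4 (insert 5 {6..n + 5}))))"
    by auto
  have "sum f {1 + 5..n + 5} = sum (\<lambda>k. f (k + 5)) {1..n}"
    by (rule sum.shift_bounds_cl_nat_ivl)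
  thus ?thesis
    unfolding I by (simp del: sum.cl_ivl_Suc add_2_eq_Suc')
qed

lemma prod_atLeast1_add5:
  fixes f :: "nat \<Rightarrow> 'a::comm_monoid_mult"
  shows "prod f {1..n + 5} = f 1 * (f 2 * (f 3 * (f 4 * (f 5 * prod (\<lambda>k. f (k + 5)) {1..n}))))"
proof -
  have I: "{1..n + 5} = insert 1 (insert 2 (insert 3 (insert 4 (insert 5 {6..n + 5}))))"
    by auto
  have "prod f {1 + 5..n + 5} = prod (\<lambda>k. f (k + 5)) {1..n}"
    by (rule prod.shift_bounds_cl_nat_ivl)
  thus ?thesis
    unfolding I by (simp del: prod.cl_ivl_Suc add_2_eq_Suc')
qed

section \<open>Legendre symbols modulo 5 and 3; exponents and signs at the poles\<close>

definition chi5 :: "nat \<Rightarrow> int" where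
  "chi5 n = (if n mod 5 \<in> {1, 4} then 1 else if n mod 5 \<in> {2, 3} then -1 else 0)"

definition chi3 :: "nat \<Rightarrow> int" where
  "chi3 n = (if n mod 3 = 1 then 1 else if n mod 3 = 2 then -1 else 0)"

text \<open>The value 1 at a = b lets \<open>sgnD\<close> run over all of \<open>poles M\<close>,
  the term m = n included.\<close>

definition inv_sgn :: "nat \<Rightarrow> nat \<Rightarrow> int" where
  "inv_sgn a b = (if a < b then -1 else 1)"

text \<open>\<open>poles M\<close> indexes the poles \<open>q\<^sup>n + q\<^sup>-\<^sup>n\<close>. At the pole of index \<open>n\<close> the numerator and the denominator
  have factors \<open>1 - q\<^sup>5\<^sup>k\<^sup>-\<^sup>2\<^sup>n\<close> and \<open>1 - q\<^sup>m\<^sup>-\<^sup>n\<close>. Those with a negative exponent are rewritten by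
  \<open>1 - q\<^sup>-\<^sup>a = - q\<^sup>-\<^sup>a (1 - q\<^sup>a)\<close>; \<open>expN\<close>, \<open>expD\<close> and \<open>sgnN\<close>, \<open>sgnD\<close> collect the powers of \<open>1/q\<close>
  and the signs produced in this way. The subtraction is truncated on purpose: the other
  factors contribute 0.\<close>

definition poles :: "nat \<Rightarrow> nat set" where
  "poles M = {n\<in>{1..5 * M}. \<not> 5 dvd n}"

definition expN :: "nat \<Rightarrow> nat \<Rightarrow> nat" where
  "expN M n = (\<Sum>k\<in>{1..M}. 2 * n - 5 * k)"

definition expD :: "nat \<Rightarrow> nat \<Rightarrow> nat" where
  "expD M n = (\<Sum>m\<in>poles M. n - m)"

definition sgnN :: "nat \<Rightarrow> nat \<Rightarrow> int" where
  "sgnN M n = (\<Prod>k\<in>{1..M}. inv_sgn (5 * k) (2 * n))"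

definition sgnD :: "nat \<Rightarrow> nat \<Rightarrow> int" where
  "sgnD M n = (\<Prod>m\<in>poles M. inv_sgn m n)"

lemma finite_poles [simp]: "finite (poles M)"
  by (simp add: poles_def)

lemma atLeast1AtMost_poles_union:
  "{1..5 * M} = poles M \<union> (*) 5 ` {1..M}"
  "poles M \<inter> (*) 5 ` {1..M} = {}"
  by (auto simp: poles_def)

lemma inv_sgn_add: "inv_sgn (a + c) (b + c) = inv_sgn a b"
  by (simp add: inv_sgn_def)

text \<open>For k > n the truncated difference \<open>2 * n - 5 * k\<close> is 0, so the sum is
  independent of M once M reaches n. For n > M terms may be missing, and only \<open>expN_le\<close>
  remains.\<close>

lemma expN_eq:
  assumes "n \<le> M"
  shows "expN M n = expN n n"
  unfolding expN_def by (rule sum.mono_neutral_right) (use assms in auto)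

lemma expN_le: "expN M n \<le> expN n n"
proof (cases "n \<le> M")
  case False
  thus ?thesis unfolding expN_def by (intro sum_mono2) auto
next
  case True
  show ?thesis by (rule eq_refl[OF expN_eq[OF True]])
qed

lemma sgnN_eq:
  assumes "n \<le> M"
  shows "sgnN M n = sgnN n n"
  unfolding sgnN_def by (rule prod.mono_neutral_right) (use assms in \<open>auto simp: inv_sgn_def\<close>)

lemma expD_eq:
  assumes "n \<le> 5 * M"
  shows "expD M n = (\<Sum>m\<in>{1..n}. if 5 dvd m then 0 else n - m)"
proof -
  have "expD M n = (\<Sum>m\<in>{1..5 * M}. if 5 dvd m then 0 else n - m)"
    unfolding expD_def poles_def by (rule sum.mono_neutral_cong_left) auto
  also have "\<dots> = (\<Sum>m\<in>{1..n}. if 5 dvd m then 0 else n - m)"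
    by (rule sum.mono_neutral_right) (use assms in auto)
  finally show ?thesis .
qed

lemma sgnD_eq:
  assumes "n \<le> 5 * M"
  shows "sgnD M n = (\<Prod>m\<in>{1..n}. if 5 dvd m then 1 else inv_sgn m n)"
proof -
  have "sgnD M n = (\<Prod>m\<in>{1..5 * M}. if 5 dvd m then 1 else inv_sgn m n)"
    unfolding sgnD_def poles_def by (rule prod.mono_neutral_cong_left) auto
  also have "\<dots> = (\<Prod>m\<in>{1..n}. if 5 dvd m then 1 else inv_sgn m n)"
    by (rule prod.mono_neutral_right) (use assms in \<open>auto simp: inv_sgn_def\<close>)
  finally show ?thesis .
qed

lemma nat_induct_step5:
  assumes "P 1" "P 2" "P 3" "P 4" "\<And>n. \<not> 5 dvd n \<Longrightarrow> P n \<Longrightarrow> P (n + 5)"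
    and "\<not> 5 dvd n"
  shows "P (n :: nat)"
  using assms(6)
proof (induction n rule: less_induct)
  case (less n)
  have "n \<noteq> 0" "n \<noteq> 5" using less.prems by (metis dvd_0_right, metis dvd_refl)
  then consider "n = 1" | "n = 2" | "n = 3" | "n = 4" | "n > 5" by linarith
  thus ?case
  proof cases
    case 5
    have "\<not> 5 dvd (n - 5)" using less.prems 5 by presburger
    thus ?thesis using less.IH[of "n - 5"] assms(5)[of "n - 5"] 5 by simp
  qed (use assms in auto)
qed

text \<open>When n grows by 5, \<open>expN n n\<close> grows by 4n + 5 and n - 1 by 5, while the
  right side grows by 4n + 10; n = 1, 2, 3, 4 are computed. Hence the exponent n - 1 in the Lambert
  series.\<close>

lemma expN_expD_diag:
  assumes "\<not> 5 dvd n"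
  shows "expN n n + (n - 1) = (\<Sum>m\<in>{1..n}. if 5 dvd m then 0 else n - m)"
  using assms
proof (induction n rule: nat_induct_step5[rotated 5, consumes 1, case_names 1 2 3 4 step])
  case (step n)
  have n: "n > 0" using step by (metis dvd_0_right gr0I)
  \<comment> \<open>The terms with k > n + 2 vanish by truncation, which leaves exactly the range of
    the shift by 2.\<close>
  have "expN (n + 5) (n + 5) = expN (n + 2) (n + 5)"
    unfolding expN_def by (rule sum.mono_neutral_right) auto
  also have "\<dots> = 4 * n + 5 + expN n n"
    unfolding expN_def sum_atLeast1_add2 by (simp add: algebra_simps)
  finally have "expN (n + 5) (n + 5) = 4 * n + 5 + expN n n" .
  moreover have "(\<Sum>m\<in>{1..n + 5}. if 5 dvd m then 0 else n + 5 - m) =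
      4 * n + 10 + (\<Sum>m\<in>{1..n}. if 5 dvd m then 0 else n - m)"
    unfolding sum_atLeast1_add5 diff_cancel2 by simp
  ultimately show ?case using step n by simp
next
  case 1 show ?case by code_simp
next
  case 2 show ?case by code_simp
next
  case 3 show ?case by code_simp
next
  case 4 show ?case by code_simp
qed

text \<open>Raising n by 5 adds two factors -1 to the numerator sign and four to the denominator
  sign, so the product has period 5; its values 1, -1, -1, 1 at n = 1, 2, 3, 4 identify it as
  \<open>chi5\<close>.\<close>

lemma sgnN_sgnD_diag:
  assumes "\<not> 5 dvd n"
  shows "sgnN n n * (\<Prod>m\<in>{1..n}. if 5 dvd m then 1 else inv_sgn m n) = chi5 n"
  using assms
proof (induction n rule: nat_induct_step5[rotated 5, consumes 1, case_names 1 2 3 4 step])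
  case (step n)
  have n: "n > 0" using step by (metis dvd_0_right gr0I)
  have "sgnN (n + 5) (n + 5) = sgnN (n + 2) (n + 5)"
    unfolding sgnN_def by (rule prod.mono_neutral_right) (auto simp: inv_sgn_def)
  also have "\<dots> = sgnN n n"
    unfolding sgnN_def prod_atLeast1_add2 using n by (simp add: inv_sgn_def algebra_simps)
  finally have "sgnN (n + 5) (n + 5) = sgnN n n" .
  moreover have "(\<Prod>m\<in>{1..n + 5}. if 5 dvd m then 1 else inv_sgn m (n + 5)) =
      (\<Prod>m\<in>{1..n}. if 5 dvd m then 1 else inv_sgn m n)"
    unfolding prod_atLeast1_add5 inv_sgn_add using n by (simp add: inv_sgn_def)
  ultimately show ?case using step by (simp add: chi5_def)
next
  case 1 show ?case by code_simp
next
  case 2 show ?case by code_simp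
next
  case 3 show ?case by code_simp
next
  case 4 show ?case by code_simp
qed

text \<open>This keeps the exponent of q at each pole nonnegative, and makes the poles with n > M
  negligible.\<close>

lemma expD_minus_expN_ge:
  assumes "n \<in> poles M"
  shows "expN M n + (n - 1) \<le> expD M n"
  using assms expN_le[of M n] expN_expD_diag[of n] by (simp add: poles_def expD_eq)

lemma expD_minus_expN_eq:
  assumes "n \<in> poles M" "n \<le> M"
  shows "expN M n + (n - 1) = expD M n"
  using assms expN_eq[of n M] expN_expD_diag[of n] by (simp add: poles_def expD_eq)

lemma sgnN_sgnD_eq:
  assumes "n \<in> poles M" "n \<le> M"
  shows "sgnN M n * sgnD M n = chi5 n"
  using assms sgnN_sgnD_diag[of n] sgnN_eq[of n M] by (simp add: poles_def sgnD_eq)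

definition adist :: "nat \<Rightarrow> nat \<Rightarrow> nat" where
  "adist a b = nat \<bar>int a - int b\<bar>"

text \<open>\<open>numer\<close> and \<open>denom\<close> are what is left at the pole of index n
  once signs and powers of \<open>1/q\<close> are extracted. The constant term of
  \<open>denom\<close> is 1, so it is invertible.\<close>

definition numer :: "nat \<Rightarrow> nat \<Rightarrow> 'a::comm_ring_1 fps" where
  "numer M n = (\<Prod>k\<in>{1..M}. (1 - fps_X ^ (5 * k + 2 * n)) * (1 - fps_X ^ adist (5 * k) (2 * n)))"

definition denom :: "nat \<Rightarrow> nat \<Rightarrow> 'a::comm_ring_1 fps" where
  "denom M n = (\<Prod>m\<in>poles M - {n}. (1 - fps_X ^ (m + n)) * (1 - fps_X ^ adist m n))"

lemma denom_nth_0: "denom M n $ 0 = 1"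
  unfolding denom_def fps_prod_nth_0
  by (rule prod.neutral) (auto simp: adist_def poles_def)

lemma one_minus_power_quotient:
  fixes Q :: "'k::field"
  assumes "Q \<noteq> 0"
  shows "(1 - Q ^ a / Q ^ b) * Q ^ (b - a) = of_int (inv_sgn a b) * (1 - Q ^ adist a b)"
proof (cases "a < b")
  case True
  hence "Q ^ b = Q ^ a * Q ^ (b - a)" "adist a b = b - a"
    by (simp_all add: adist_def flip: power_add)
  thus ?thesis using assms True by (simp add: inv_sgn_def field_simps)
next
  case False
  hence "Q ^ a = Q ^ b * Q ^ (a - b)" "adist a b = a - b"
    by (simp_all add: adist_def flip: power_add)
  thus ?thesis using assms False by (simp add: inv_sgn_def)
qed

section \<open>Passage through the field of fractions, where \<open>1/q\<close> exists\<close>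

lemma to_fract_power: "to_fract (x ^ n) = to_fract x ^ n"
  by (induction n) auto

lemma to_fract_prod: "to_fract (\<Prod>x\<in>A. f x) = (\<Prod>x\<in>A. to_fract (f x))"
  by (induction A rule: infinite_finite_induct) auto

lemma to_fract_sum: "to_fract (\<Sum>x\<in>A. f x) = (\<Sum>x\<in>A. to_fract (f x))"
  by (induction A rule: infinite_finite_induct) auto

lemma to_fract_of_nat: "to_fract (of_nat k) = of_nat k"
  by (induction k) auto

lemma to_fract_of_int: "to_fract (of_int k) = of_int k"
  by (cases k rule: int_cases2) (auto simp: to_fract_of_nat)

lemma fps_X_power_inj: "fps_X ^ a = (fps_X ^ b :: 'a::comm_ring_1 fps) \<longleftrightarrow> a = b"
  by (metis fps_X_power_nth zero_neq_one)

text \<open>Lagrange interpolation at the 4M nodes \<open>Q ^ n + 1 / Q ^ n\<close>, evaluated at t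
  = -1; the numerator has degree at most 2M.\<close>

lemma partial_fractions:
  fixes Q :: "'k::field"
  assumes Q0: "Q \<noteq> 0" and Qinj: "\<And>a b. Q ^ a = Q ^ b \<longleftrightarrow> a = b" and "M > 0"
  shows "(\<Prod>k\<in>{1..M}. 1 + Q ^ (5 * k) + Q ^ (2 * (5 * k))) =
    (\<Sum>n\<in>poles M. (\<Prod>k\<in>{1..M}. (1 - Q ^ (5 * k + 2 * n)) * (1 - Q ^ (5 * k) / Q ^ (2 * n))) *
       (\<Prod>m\<in>poles M - {n}. (1 + Q ^ m + Q ^ (2 * m)) / ((1 - Q ^ (m + n)) * (1 - Q ^ m / Q ^ n))))"
proof -
  define x where "x = (\<lambda>n. Q ^ n + 1 / Q ^ n)"
  \<comment> \<open>With \<open>a = Q ^ (5 * k)\<close> and \<open>t = y + 1/y\<close>, one has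
    \<open>(1 - a y\<^sup>2)(1 - a / y\<^sup>2) = 1 + 2a + a\<^sup>2 - a t\<^sup>2\<close>.\<close>
  define p where "p = (\<Prod>k\<in>{1..M}. [:1 + 2 * Q ^ (5 * k) + Q ^ (2 * (5 * k)), 0, - (Q ^ (5 * k)):])"
  have diff: "x n - x m = - ((1 - Q ^ (m + n)) * (1 - Q ^ m / Q ^ n) / Q ^ m)" for m n
    using Q0 by (simp add: x_def field_simps power_add)
  have "inj_on x (poles M)"
  proof (rule inj_onI)
    fix n m assume nm: "n \<in> poles M" "m \<in> poles M" "x n = x m"
    hence "(1 - Q ^ (m + n)) * (1 - Q ^ m / Q ^ n) = 0"
      using diff[of n m] Q0 by simp
    hence "Q ^ (m + n) = Q ^ 0 \<or> Q ^ m = Q ^ n"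
      using Q0 by auto
    thus "n = m" unfolding Qinj using nm by (auto simp: poles_def)
  qed
  moreover have "degree p < card (poles M)"
  proof -
    have "degree p \<le> (\<Sum>k\<in>{1..M}. degree [:1 + 2 * Q ^ (5 * k) + Q ^ (2 * (5 * k)), 0, - (Q ^ (5 * k)):])"
      unfolding p_def by (rule degree_prod_sum_le[unfolded o_def]) simp
    also have "\<dots> \<le> (\<Sum>k\<in>{1..M}. 2)"
      by (intro sum_mono) simp
    also have "\<dots> < 4 * M" using \<open>M > 0\<close> by simp
    also have "4 * M = card (poles M)"
    proof -
      have "card {1..5 * M} = card (poles M) + card ((*) 5 ` {1..M})"
        unfolding atLeast1AtMost_poles_union(1)
        by (rule card_Un_disjoint) (simp_all only: atLeast1AtMost_poles_union(2) finite_poles finite_imageI finite_atLeastAtMost)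
      moreover have "card ((*) 5 ` {1..M}) = M"
        by (subst card_image) (auto simp: inj_on_def)
      ultimately show ?thesis by simp
    qed
    finally show ?thesis .
  qed
  ultimately have "poly p (- 1) =
      (\<Sum>n\<in>poles M. poly p (x n) * (\<Prod>m\<in>poles M - {n}. (- 1 - x m) / (x n - x m)))"
    by (intro lagrange_interpolation) simp_all
  moreover have "poly p (- 1) = (\<Prod>k\<in>{1..M}. 1 + Q ^ (5 * k) + Q ^ (2 * (5 * k)))"
    unfolding p_def poly_prod by (intro prod.cong) simp_all
  moreover have "poly p (x n) = (\<Prod>k\<in>{1..M}. (1 - Q ^ (5 * k + 2 * n)) * (1 - Q ^ (5 * k) / Q ^ (2 * n)))" for n
  proof -
    have "1 + 2 * a + a * a - x n * (x n * a) = (1 - a * (Q ^ n * Q ^ n)) * (1 - a / (Q ^ n * Q ^ n))" for a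
      using Q0 by (simp add: x_def field_simps)
    thus ?thesis
      unfolding p_def poly_prod mult_2 power_add by (intro prod.cong) simp_all
  qed
  moreover have "(- 1 - x m) / (x n - x m) =
      (1 + Q ^ m + Q ^ (2 * m)) / ((1 - Q ^ (m + n)) * (1 - Q ^ m / Q ^ n))" for m n
  proof -
    have "- 1 - x m = - ((1 + Q ^ m + Q ^ (2 * m)) / Q ^ m)"
      unfolding mult_2 power_add x_def using Q0 by (simp add: field_simps)
    moreover have "(- (a / c)) / (- (b / c)) = a / b" if "c \<noteq> 0" for a b c :: 'k
      using that by simp
    ultimately show ?thesis unfolding diff[of n m] using Q0 by (metis power_not_zero)
  qed
  ultimately show ?thesis by simp
qed

text \<open>The powers of \<open>q\<close> cancel up to a nonnegative exponent, so the expansion holds without denominators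
  in the ring of power series.\<close>

lemma prod_trinomial_eq:
  assumes "M > 0"
  shows "(\<Prod>k\<in>{1..M}. trinomial (5 * k) :: 'a::idom fps) =
    (\<Sum>n\<in>poles M. of_int (sgnN M n * sgnD M n) * fps_X ^ (expD M n - expN M n) *
       (numer M n * fps_recip (denom M n)) * (\<Prod>m\<in>poles M - {n}. trinomial m))"
proof -
  define Q where "Q = to_fract (fps_X :: 'a fps)"
  have Q0: "Q \<noteq> 0" by (simp add: Q_def)
  have Qinj: "Q ^ a = Q ^ b \<longleftrightarrow> a = b" for a b
    by (simp add: Q_def fps_X_power_inj flip: to_fract_power)
  have trinomial: "to_fract (trinomial m) = 1 + Q ^ m + Q ^ (2 * m)" for m
    by (simp add: trinomial_def Q_def to_fract_power)
  have one: "to_fract (1 - fps_X ^ m) = 1 - Q ^ m" for m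
    by (simp add: Q_def to_fract_power)
  have summand: "(\<Prod>k\<in>{1..M}. (1 - Q ^ (5 * k + 2 * n)) * (1 - Q ^ (5 * k) / Q ^ (2 * n))) *
       (\<Prod>m\<in>poles M - {n}. (1 + Q ^ m + Q ^ (2 * m)) / ((1 - Q ^ (m + n)) * (1 - Q ^ m / Q ^ n))) =
     to_fract (of_int (sgnN M n * sgnD M n) * fps_X ^ (expD M n - expN M n) *
       (numer M n * fps_recip (denom M n)) * (\<Prod>m\<in>poles M - {n}. trinomial m))" (is "?P * ?W = _")
    if n: "n \<in> poles M" for n
  proof -
    define D where "D = (\<Prod>m\<in>poles M - {n}. (1 - Q ^ (m + n)) * (1 - Q ^ m / Q ^ n))"
    have W: "?W = to_fract (\<Prod>m\<in>poles M - {n}. trinomial m) / D"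
      by (simp add: D_def to_fract_prod trinomial prod_dividef)
    have P: "?P * Q ^ expN M n = of_int (sgnN M n) * to_fract (numer M n)"
      unfolding expN_def sgnN_def numer_def power_sum of_int_prod to_fract_prod to_fract_mult one
        prod.distrib[symmetric]
      by (intro prod.cong refl) (simp only: mult.assoc one_minus_power_quotient[OF Q0] mult.left_commute)
    have "expD M n = (\<Sum>m\<in>poles M - {n}. n - m)" "sgnD M n = (\<Prod>m\<in>poles M - {n}. inv_sgn m n)"
      using n by (simp_all add: expD_def sgnD_def sum.remove prod.remove inv_sgn_def)
    hence D: "D * Q ^ expD M n = of_int (sgnD M n) * to_fract (denom M n)"
      unfolding D_def denom_def to_fract_prod to_fract_mult one
      by (simp only: power_sum of_int_prod prod.distrib[symmetric])
         (intro prod.cong refl, simp only: mult.assoc one_minus_power_quotient[OF Q0] mult.left_commute)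
    have recip: "to_fract (denom M n) * to_fract (fps_recip (denom M n)) = 1"
      by (simp only: to_fract_mult[symmetric] fps_recip_mult[OF denom_nth_0] to_fract_1)
    have s2: "sgnD M n * sgnD M n = 1"
      unfolding sgnD_def prod.distrib[symmetric] by (rule prod.neutral) (simp add: inv_sgn_def)
    have "D * (Q ^ expD M n * (of_int (sgnD M n) * to_fract (fps_recip (denom M n)))) =
        of_int (sgnD M n * sgnD M n) * (to_fract (denom M n) * to_fract (fps_recip (denom M n)))"
      unfolding mult.assoc[symmetric] D by (simp only: of_int_mult mult_ac)
    hence D_inv: "1 / D = Q ^ expD M n * (of_int (sgnD M n) * to_fract (fps_recip (denom M n)))"
      unfolding recip s2 by (metis mult.right_neutral nonzero_mult_div_cancel_left mult_zero_left of_int_1 zero_neq_one)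
    \<comment> \<open>Part of the power supplied by the denominator clears the negative powers in
      \<open>?P\<close>.\<close>
    have "Q ^ expD M n = Q ^ expN M n * Q ^ (expD M n - expN M n)"
      using expD_minus_expN_ge[OF n] by (simp flip: power_add)
    hence "?P * ?W = (?P * Q ^ expN M n) * Q ^ (expD M n - expN M n) *
        (of_int (sgnD M n) * to_fract (fps_recip (denom M n))) * to_fract (\<Prod>m\<in>poles M - {n}. trinomial m)"
      using W D_inv by (simp add: divide_inverse mult_ac)
    also have "\<dots> = to_fract (of_int (sgnN M n * sgnD M n) * fps_X ^ (expD M n - expN M n) *
       (numer M n * fps_recip (denom M n)) * (\<Prod>m\<in>poles M - {n}. trinomial m))"
      unfolding P by (simp only: to_fract_mult to_fract_of_int of_int_mult to_fract_power Q_def[symmetric] mult_ac)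
    finally show ?thesis .
  qed
  have "to_fract (\<Prod>k\<in>{1..M}. trinomial (5 * k) :: 'a fps) = to_fract (\<Sum>n\<in>poles M. of_int (sgnN M n * sgnD M n) *
      fps_X ^ (expD M n - expN M n) * (numer M n * fps_recip (denom M n)) * (\<Prod>m\<in>poles M - {n}. trinomial m))"
    unfolding to_fract_sum to_fract_prod[of _ "{1..M}"] trinomial partial_fractions[OF Q0 Qinj assms]
    by (intro sum.cong refl) (rule summand)
  thus ?thesis by (simp only: to_fract_eq_iff)
qed

section \<open>The limit of the residues\<close>

definition euler :: "nat set \<Rightarrow> 'a::comm_ring_1 fps" where
  "euler A = (\<Prod>j\<in>A. 1 - fps_X ^ j)"

lemma euler_nth_0: "0 \<notin> A \<Longrightarrow> euler A $ 0 = 1"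
  unfolding euler_def fps_prod_nth_0 by (rule prod.neutral) (auto intro!: gr0I)

lemma eq_upto_euler:
  assumes "finite A" "A \<inter> {..d} = B"
  shows "eq_upto d (euler A) (euler B)"
  unfolding euler_def
  by (rule eq_upto_prod_subset) (use assms in \<open>auto intro!: eq_upto_one_minus_X\<close>)

text \<open>If no exponent is repeated, only the set of exponents up to d matters.\<close>

lemma eq_upto_prod_inj:
  fixes h :: "'b \<Rightarrow> nat"
  assumes "finite K" "inj_on h K" "h ` K \<inter> {..d} = B"
  shows "eq_upto d (\<Prod>k\<in>K. 1 - fps_X ^ h k :: 'a::comm_ring_1 fps) (euler B)"
proof -
  have "(\<Prod>k\<in>K. 1 - fps_X ^ h k :: 'a fps) = euler (h ` K)"
    unfolding euler_def by (simp add: prod.reindex assms)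
  thus ?thesis using eq_upto_euler[of "h ` K" d B] assms by simp
qed

lemma prod_int_symmetric:
  fixes g :: "int \<Rightarrow> 'a::comm_monoid_mult"
  shows "(\<Prod>k\<in>{- int M..int M}. g k) = g 0 * (\<Prod>k\<in>{1..M}. g (int k) * g (- int k))"
proof (induction M)
  case (Suc M)
  have "{- int (Suc M)..int (Suc M)} =
      insert (int (Suc M)) (insert (- int (Suc M)) {- int M..int M})"
    by auto
  thus ?case using Suc by (simp add: mult_ac)
qed simp

section \<open>Products over residue classes modulo 5\<close>

definition resid :: "nat \<Rightarrow> nat \<Rightarrow> nat set" where
  "resid d c = {j\<in>{1..d}. (5::int) dvd int j - int c \<or> (5::int) dvd int j + int c}"

lemma resid_eq_mod:
  "resid d c = {j\<in>{1..d}. int j mod 5 = int c mod 5 \<or> int j mod 5 = (- int c) mod 5}"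
  by (simp add: resid_def mod_eq_dvd_iff)

text \<open>For n prime to 5, the residues n, -n, 2n, -2n are exactly the nonzero ones modulo
  5.\<close>

lemma euler_resid:
  assumes "\<not> 5 dvd n"
  shows "euler {1..d} = (euler (resid d n) * euler (resid d (2 * n)) * euler {j\<in>{1..d}. 5 dvd j} :: 'a::comm_ring_1 fps)"
proof -
  have "int n mod 5 = 1 \<or> int n mod 5 = 2 \<or> int n mod 5 = 3 \<or> int n mod 5 = 4"
    using assms by presburger
  hence "resid d n = {j\<in>{1..d}. int j mod 5 \<in> {1, 4}} \<and> resid d (2 * n) = {j\<in>{1..d}. int j mod 5 \<in> {2, 3}} \<or>
      resid d n = {j\<in>{1..d}. int j mod 5 \<in> {2, 3}} \<and> resid d (2 * n) = {j\<in>{1..d}. int j mod 5 \<in> {1, 4}}"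
  proof (elim disjE)
    assume *: "int n mod 5 = 1"
    have "(- int n) mod 5 = 4" "int (2 * n) mod 5 = 2" "(- int (2 * n)) mod 5 = 3"
      using * by presburger+
    thus ?thesis using * unfolding resid_eq_mod by auto
  next
    assume *: "int n mod 5 = 2"
    have "(- int n) mod 5 = 3" "int (2 * n) mod 5 = 4" "(- int (2 * n)) mod 5 = 1"
      using * by presburger+
    thus ?thesis using * unfolding resid_eq_mod by auto
  next
    assume *: "int n mod 5 = 3"
    have "(- int n) mod 5 = 2" "int (2 * n) mod 5 = 1" "(- int (2 * n)) mod 5 = 4"
      using * by presburger+
    thus ?thesis using * unfolding resid_eq_mod by auto
  next
    assume *: "int n mod 5 = 4"
    have "(- int n) mod 5 = 1" "int (2 * n) mod 5 = 3" "(- int (2 * n)) mod 5 = 2"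
      using * by presburger+
    thus ?thesis using * unfolding resid_eq_mod by auto
  qed
  note resid_eq = this
  have zero: "5 dvd j \<longleftrightarrow> int j mod 5 = 0" for j
    by presburger
  have all: "int j mod 5 = 0 \<or> int j mod 5 = 1 \<or> int j mod 5 = 2 \<or> int j mod 5 = 3 \<or> int j mod 5 = 4" for j
    by presburger
  have U: "{1..d} = (resid d n \<union> resid d (2 * n)) \<union> {j\<in>{1..d}. 5 dvd j}"
  proof (rule set_eqI)
    fix j
    show "j \<in> {1..d} \<longleftrightarrow> j \<in> resid d n \<union> resid d (2 * n) \<union> {j\<in>{1..d}. 5 dvd j}"
      using resid_eq all[of j] unfolding zero by (elim disjE conjE) simp_all
  qed
  have D: "(resid d n \<union> resid d (2 * n)) \<inter> {j\<in>{1..d}. 5 dvd j} = {}"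
    "resid d n \<inter> resid d (2 * n) = {}"
    using resid_eq unfolding zero by auto
  have fin: "finite (resid d c)" for c
    by (simp add: resid_def)
  have "euler {1..d} = (euler ((resid d n \<union> resid d (2 * n)) \<union> {j\<in>{1..d}. 5 dvd j}) :: 'a fps)"
    by (simp only: U[symmetric])
  also have "\<dots> = euler (resid d n \<union> resid d (2 * n)) * euler {j\<in>{1..d}. 5 dvd j}"
    unfolding euler_def by (rule prod.union_disjoint) (use fin D in auto)
  also have "euler (resid d n \<union> resid d (2 * n)) = (euler (resid d n) * euler (resid d (2 * n)) :: 'a fps)"
    unfolding euler_def by (rule prod.union_disjoint) (use fin D in auto)
  finally show ?thesis .
qed

text \<open>As \<open>k\<close> runs through the integers, \<open>|5k + c|\<close> takes every positive value congruent to \<open>c\<close> or \<open>-c\<close>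
  exactly once.\<close>

lemma progression_prod:
  assumes "\<not> 5 dvd c" "c + d \<le> 5 * M"
  shows "eq_upto d (\<Prod>k\<in>{- int M..int M}. 1 - fps_X ^ nat \<bar>5 * k + int c\<bar>) (euler (resid d c))"
proof (rule eq_upto_prod_inj)
  show "inj_on (\<lambda>k. nat \<bar>5 * k + int c\<bar>) {- int M..int M}"
  proof (rule inj_onI)
    fix k l assume "nat \<bar>5 * k + int c\<bar> = nat \<bar>5 * l + int c\<bar>"
    hence "5 * k + int c = 5 * l + int c \<or> 5 * k + int c = - (5 * l + int c)" by linarith
    thus "k = l"
    proof
      assume "5 * k + int c = - (5 * l + int c)"
      hence "2 * int c = 5 * (- k - l)" by simp
      hence "(5::int) dvd 2 * int c" by (metis dvd_triv_left)
      thus ?thesis using assms(1) by presburger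
    qed simp
  qed
  show "(\<lambda>k. nat \<bar>5 * k + int c\<bar>) ` {- int M..int M} \<inter> {..d} = resid d c"
  proof (intro equalityI subsetI)
    fix j assume "j \<in> (\<lambda>k. nat \<bar>5 * k + int c\<bar>) ` {- int M..int M} \<inter> {..d}"
    then obtain k where k: "j = nat \<bar>5 * k + int c\<bar>" "j \<le> d" by auto
    have "(5::int) dvd int j - int c \<or> (5::int) dvd int j + int c"
    proof (cases "5 * k + int c \<ge> 0")
      case True
      hence "int j - int c = 5 * k" using k by simp
      thus ?thesis by simp
    next
      case False
      hence "int j + int c = 5 * (- k)" using k by simp
      thus ?thesis by (metis dvd_triv_left)
    qed
    moreover have "j \<noteq> 0"
    proof
      assume "j = 0"
      hence "int c = 5 * (- k)" using k by simp
      hence "(5::int) dvd int c" by (metis dvd_triv_left)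
      thus False using assms(1) by presburger
    qed
    ultimately show "j \<in> resid d c" using k by (simp add: resid_def)
  next
    fix j assume "j \<in> resid d c"
    hence j: "1 \<le> j" "j \<le> d" "(5::int) dvd int j - int c \<or> (5::int) dvd int j + int c"
      by (auto simp: resid_def)
    then obtain k where k: "int j = 5 * k + int c \<or> int j = - (5 * k + int c)"
    proof (elim disjE dvdE)
      fix l assume "int j - int c = 5 * l"
      thus thesis using that[of l] by simp
    next
      fix l assume "int j + int c = 5 * l"
      thus thesis using that[of "- l"] by simp
    qed
    have "j = nat \<bar>5 * k + int c\<bar>" "k \<in> {- int M..int M}"
      using k j assms(2) by auto
    thus "j \<in> (\<lambda>k. nat \<bar>5 * k + int c\<bar>) ` {- int M..int M} \<inter> {..d}"
      using j by blast
  qed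
qed simp

text \<open>The factors of \<open>numer\<close> are those of index k and -k in the progression 5k +
  2n; the extra factor supplies k = 0.\<close>

lemma numer_cong:
  assumes "\<not> 5 dvd n" "2 * n + d \<le> 5 * M"
  shows "eq_upto d (numer M n * (1 - fps_X ^ (2 * n)) :: 'a::comm_ring_1 fps) (euler (resid d (2 * n)))"
proof -
  have "(\<Prod>k\<in>{- int M..int M}. 1 - fps_X ^ nat \<bar>5 * k + int (2 * n)\<bar> :: 'a fps) =
      numer M n * (1 - fps_X ^ (2 * n))"
  proof -
    have "nat \<bar>5 * int k + int (2 * n)\<bar> = 5 * k + 2 * n"
      "nat \<bar>5 * (- int k) + int (2 * n)\<bar> = adist (5 * k) (2 * n)" for k
      unfolding adist_def by linarith+
    moreover have "nat \<bar>5 * 0 + int (2 * n)\<bar> = 2 * n" by simp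
    ultimately show ?thesis
      unfolding prod_int_symmetric numer_def by (simp only: mult.commute)
  qed
  moreover have "\<not> 5 dvd 2 * n" using assms by presburger
  ultimately show ?thesis using progression_prod[of "2 * n" d M] assms by metis
qed

text \<open>Restoring the factor of index \<open>n\<close> and the multiples of 5 completes the denominator to the product of
  \<open>1 - q\<^sup>|\<^sup>j\<^sup>+\<^sup>n\<^sup>|\<close> over all \<open>j \<noteq> -n\<close>, in which each exponent up to \<open>d\<close> occurs twice.\<close>

lemma denom_cong:
  assumes n: "n \<in> poles M" and d: "n + d \<le> 5 * M"
  shows "eq_upto d (denom M n * ((1 - fps_X ^ (2 * n)) * euler (resid d n)) :: 'a::comm_ring_1 fps) (euler {1..d} * euler {1..d})"
proof -
  have n5: "\<not> 5 dvd n" "n > 0" "n \<le> 5 * M" using n by (auto simp: poles_def)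
  \<comment> \<open>The factor at j = -n would be \<open>1 - q\<^sup>0 = 0\<close>, so it is
    replaced by 1.\<close>
  define g where "g = (\<lambda>j. if j = - int n then 1 else 1 - fps_X ^ nat \<bar>j + int n\<bar> :: 'a fps)"
  have eq: "(\<Prod>j\<in>{- int (5 * M)..int (5 * M)}. g j) =
      denom M n * ((1 - fps_X ^ (2 * n)) * (\<Prod>k\<in>{- int M..int M}. 1 - fps_X ^ nat \<bar>5 * k + int n\<bar>))"
  proof -
    have union: "(\<Prod>j\<in>{1..5 * M}. g (int j) * g (- int j)) =
        (\<Prod>m\<in>poles M. g (int m) * g (- int m)) * (\<Prod>j\<in>(*) 5 ` {1..M}. g (int j) * g (- int j))"
      unfolding atLeast1AtMost_poles_union(1)
      by (rule prod.union_disjoint) (simp_all only: atLeast1AtMost_poles_union(2) finite_poles finite_imageI finite_atLeastAtMost)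
    have mult5: "(\<Prod>j\<in>(*) 5 ` {1..M}. g (int j) * g (- int j)) =
        (\<Prod>k\<in>{1..M}. g (5 * int k) * g (5 * (- int k)))"
      by (subst prod.reindex) (auto simp: inj_on_def)
    have pole: "(\<Prod>m\<in>poles M. g (int m) * g (- int m)) =
        (g (int n) * g (- int n)) * (\<Prod>m\<in>poles M - {n}. g (int m) * g (- int m))"
      by (rule prod.remove) (use n in auto)
    have gn: "g (int n) * g (- int n) = 1 - fps_X ^ (2 * n)"
    proof -
      have "nat \<bar>int n + int n\<bar> = 2 * n" "int n \<noteq> - int n" using n5 by auto
      thus ?thesis by (simp only: g_def if_False if_True refl mult_1_right)
    qed
    have den: "(\<Prod>m\<in>poles M - {n}. g (int m) * g (- int m)) = denom M n"
      unfolding denom_def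
    proof (rule prod.cong)
      fix m assume m: "m \<in> poles M - {n}"
      have "nat \<bar>int m + int n\<bar> = m + n" "nat \<bar>- int m + int n\<bar> = adist m n"
        unfolding adist_def by linarith+
      moreover have "int m \<noteq> - int n" "- int m \<noteq> - int n" using m n5 by auto
      ultimately show "g (int m) * g (- int m) = (1 - fps_X ^ (m + n)) * (1 - fps_X ^ adist m n)"
        by (simp only: g_def if_False if_True refl mult_1_right)
    qed simp
    have g5: "(\<Prod>k\<in>{- int M..int M}. g (5 * k)) = (\<Prod>k\<in>{- int M..int M}. 1 - fps_X ^ nat \<bar>5 * k + int n\<bar>)"
    proof (rule prod.cong)
      fix k
      have "5 * k \<noteq> - int n" using n5 by presburger
      thus "g (5 * k) = 1 - fps_X ^ nat \<bar>5 * k + int n\<bar>" by (simp add: g_def)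
    qed simp
    have rhs: "(\<Prod>k\<in>{- int M..int M}. 1 - fps_X ^ nat \<bar>5 * k + int n\<bar>) =
        g 0 * (\<Prod>k\<in>{1..M}. g (5 * int k) * g (5 * (- int k)))"
      using prod_int_symmetric[of "\<lambda>k. g (5 * k)" M] unfolding g5 mult_zero_right .
    show ?thesis
      unfolding rhs unfolding prod_int_symmetric union mult5 pole gn den
      by (simp only: mult_ac)
  qed
  note eq
  moreover have "eq_upto d (\<Prod>j\<in>{- int (5 * M)..int (5 * M)}. g j) (euler {1..d} * euler {1..d})"
  proof -
    have split: "{- int (5 * M)..int (5 * M)} =
        insert (- int n) ({- int (5 * M)..- int n - 1} \<union> {- int n + 1..int (5 * M)})"
      using n5 by auto
    have "(\<Prod>j\<in>{- int (5 * M)..int (5 * M)}. g j) =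
        (\<Prod>j\<in>{- int (5 * M)..- int n - 1}. g j) * (\<Prod>j\<in>{- int n + 1..int (5 * M)}. g j)"
      unfolding split by (subst prod.insert; (subst prod.union_disjoint)?; auto simp: g_def)
    also have "\<dots> = (\<Prod>j\<in>{- int (5 * M)..- int n - 1}. 1 - fps_X ^ nat \<bar>j + int n\<bar>) *
        (\<Prod>j\<in>{- int n + 1..int (5 * M)}. 1 - fps_X ^ nat \<bar>j + int n\<bar>)"
      by (intro arg_cong2[of _ _ _ _ "(*)"] prod.cong) (auto simp: g_def)
    also have "eq_upto d \<dots> (euler {1..d} * euler {1..d})"
    proof (intro eq_upto_mult eq_upto_prod_inj)
      have "j \<in> (\<lambda>j. nat \<bar>j + int n\<bar>) ` {- int (5 * M)..- int n - 1}" if "1 \<le> j" "j \<le> d" for j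
        by (rule image_eqI[of _ _ "- int n - int j"]) (use that d in auto)
      thus "(\<lambda>j. nat \<bar>j + int n\<bar>) ` {- int (5 * M)..- int n - 1} \<inter> {..d} = {1..d}"
        by auto
      have "j \<in> (\<lambda>j. nat \<bar>j + int n\<bar>) ` {- int n + 1..int (5 * M)}" if "1 \<le> j" "j \<le> d" for j
        by (rule image_eqI[of _ _ "int j - int n"]) (use that d in auto)
      thus "(\<lambda>j. nat \<bar>j + int n\<bar>) ` {- int n + 1..int (5 * M)} \<inter> {..d} = {1..d}"
        by auto
    qed (auto simp: inj_on_def)
    finally show ?thesis .
  qed
  ultimately have "eq_upto d (denom M n * ((1 - fps_X ^ (2 * n)) *
      (\<Prod>k\<in>{- int M..int M}. 1 - fps_X ^ nat \<bar>5 * k + int n\<bar>)) :: 'a fps) (euler {1..d} * euler {1..d})"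
    by simp
  moreover have "eq_upto d (denom M n * ((1 - fps_X ^ (2 * n)) *
      (\<Prod>k\<in>{- int M..int M}. 1 - fps_X ^ nat \<bar>5 * k + int n\<bar>)) :: 'a fps)
      (denom M n * ((1 - fps_X ^ (2 * n)) * euler (resid d n)))"
    by (intro eq_upto_mult eq_upto_refl progression_prod) (use n5 d in auto)
  ultimately show ?thesis using eq_upto_sym eq_upto_trans by blast
qed

text \<open>Let A and B be the products over the exponents congruent to n or -n, and to 2n or -2n.
  Up to \<open>q\<^sup>d\<close> the factor \<open>1 - q\<^sup>2\<^sup>n\<close> cancels in the
  quotient, which becomes \<open>A B / f\<^sub>1\<^sup>2\<close>; then
  \<open>f\<^sub>1 = A B f\<^sub>5\<close> gives \<open>1 / (f\<^sub>1 f\<^sub>5)\<close>.\<close>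

lemma numer_denom_cong:
  assumes n: "n \<in> poles M" and d: "2 * n + d \<le> 5 * M"
  shows "eq_upto d (euler {1..d} * euler {j\<in>{1..d}. 5 dvd j} * (numer M n * fps_recip (denom M n)) :: 'a::comm_ring_1 fps) 1"
proof -
  have n5: "\<not> 5 dvd n" "n > 0" using n by (auto simp: poles_def)
  let ?f1 = "euler {1..d} :: 'a fps" and ?f5 = "euler {j\<in>{1..d}. 5 dvd j} :: 'a fps"
  let ?A = "euler (resid d n) :: 'a fps" and ?B = "euler (resid d (2 * n)) :: 'a fps"
  let ?N = "numer M n :: 'a fps" and ?D = "denom M n :: 'a fps"
  let ?u = "(1 - fps_X ^ (2 * n)) * ?A"
  have "(?f1 * ?f5 * ?N) * ?u = (?N * (1 - fps_X ^ (2 * n))) * (?f1 * ?f5 * ?A)"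
    by (simp only: mult_ac)
  also have "eq_upto d \<dots> (?B * (?f1 * ?f5 * ?A))"
    using n5 d by (intro eq_upto_mult numer_cong) auto
  also have "?B * (?f1 * ?f5 * ?A) = ?f1 * (?A * ?B * ?f5)"
    by (simp only: mult_ac)
  also have "\<dots> = ?f1 * ?f1"
    using euler_resid[OF n5(1), of d, where 'a = 'a] by simp
  also have "eq_upto d \<dots> (?D * ?u)"
    using n d by (intro eq_upto_sym[OF denom_cong]) auto
  finally have "eq_upto d (?f1 * ?f5 * ?N) ?D"
    by (rule eq_upto_cancel) (use n5 in \<open>simp add: euler_nth_0 resid_def\<close>)
  from eq_upto_mult[OF this eq_upto_refl[of d "fps_recip ?D"]] show ?thesis
    by (simp add: fps_recip_mult denom_nth_0 mult.assoc)
qed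

section \<open>The Lambert series and its vanishing coefficients\<close>

lemma chi3_sum3: "chi3 (i + 2) + chi3 (i + 1) + chi3 i = 0"
proof -
  have "i mod 3 = 0 \<or> i mod 3 = 1 \<or> i mod 3 = 2" by linarith
  thus ?thesis by (elim disjE) (simp_all add: chi3_def mod_Suc numeral_2_eq_2)
qed

text \<open>\<open>1 / (1 + x + x\<^sup>2) = (1 - x) / (1 - x\<^sup>3)\<close> has the repeating
  coefficients 1, -1, 0. The proof multiplies back, and \<open>chi3_sum3\<close> is the
  recurrence.\<close>

lemma fps_recip_trinomial_nth:
  assumes "n > 0"
  shows "fps_recip (trinomial n) $ j = (if n dvd j then of_int (chi3 (j div n + 1)) else 0 :: 'a::comm_ring_1)"
proof -
  define F where "F = (\<lambda>j. if n dvd j then of_int (chi3 (j div n + 1)) else 0 :: 'a)"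
  have sh: "(fps_X ^ k * Abs_fps F) $ j = (if j < k then 0 else F (j - k))" for k j
    by (simp add: fps_X_power_mult_nth)
  have "trinomial n * Abs_fps F = 1"
  proof (rule fps_ext)
    fix j
    have e: "(trinomial n * Abs_fps F) $ j =
        F j + (if j < n then 0 else F (j - n)) + (if j < 2 * n then 0 else F (j - 2 * n))"
      unfolding trinomial_def by (simp only: distrib_right fps_add_nth sh mult_1_left fps_nth_Abs_fps)
    show "(trinomial n * Abs_fps F) $ j = 1 $ j"
    proof (cases "n dvd j")
      case False
      have "F (j - k * n) = 0" if "\<not> j < k * n" for k
        using that False by (metis F_def dvd_triv_right dvd_add_right_iff le_add_diff_inverse not_less)
      from this[of 1] this[of 2] have "\<not> j < n \<longrightarrow> F (j - n) = 0" "\<not> j < 2 * n \<longrightarrow> F (j - 2 * n) = 0"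
        by simp_all
      moreover have "j \<noteq> 0" using False by (metis dvd_0_right)
      moreover have "F j = 0" using False by (simp add: F_def)
      ultimately show ?thesis
        unfolding e by simp
    next
      case True
      then obtain i where i: "j = n * i" ..
      have Fi: "F (n * i) = of_int (chi3 (i + 1))" for i
        using assms by (simp add: F_def)
      consider "i = 0" | "i = 1" | l where "i = l + 2"
        by (metis One_nat_def add_2_eq_Suc' not0_implies_Suc)
      thus ?thesis
      proof cases
        case 1
        thus ?thesis using assms unfolding e unfolding i by (simp add: F_def chi3_def)
      next
        case 2
        thus ?thesis using assms Fi[of 0] Fi[of 1] unfolding e unfolding i by (simp add: chi3_def)
      next
        case (3 l)
        have "n * (l + 2) - n = n * (l + 1)" "n * (l + 2) - 2 * n = n * l"
          by (simp_all add: algebra_simps)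
        moreover have "\<not> n * (l + 2) < n" "\<not> n * (l + 2) < 2 * n"
          by (simp_all add: algebra_simps)
        moreover have "n * (l + 2) \<noteq> 0" using assms by simp
        ultimately have "(trinomial n * Abs_fps F) $ j = of_int (chi3 (l + 1 + 2) + chi3 (l + 1 + 1) + chi3 (l + 1))"
          unfolding e unfolding i 3 of_int_add by (simp only: if_False Fi) (simp add: add_ac)
        thus ?thesis using \<open>n * (l + 2) \<noteq> 0\<close> unfolding chi3_sum3 i 3 by simp
      qed
    qed
  qed
  hence "Abs_fps F = fps_recip (trinomial n)"
    by (rule fps_recip_unique[rotated]) (use assms in \<open>simp add: trinomial_nth_0\<close>)
  thus ?thesis by (metis F_def fps_nth_Abs_fps)
qed

text \<open>\<open>C5_factor\<close> with \<open>\<zeta>\<close> replaced by a primitive cube root of unity.\<close>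

definition C5_omega_factor :: "nat \<Rightarrow> 'a::comm_ring_1 fps" where
  "C5_omega_factor n =
     (1 - fps_X ^ n) * (1 - fps_X ^ (5 * n)) * trinomial (5 * n) * trinomial (5 * n) * fps_recip (trinomial n)"

lemma eq_upto_trinomial: "d < n \<Longrightarrow> eq_upto d (trinomial n) 1"
  by (auto simp: eq_upto_def trinomial_def fps_X_power_nth)

text \<open>The trinomials over the poles and one of the two products over multiples of 5 give all
  indices up to 5M; up to \<open>q\<^sup>d\<close> these cancel the reciprocals.\<close>

lemma C5_omega_times_poles:
  assumes "d \<le> M"
  shows "eq_upto d ((\<Prod>n\<in>{1..M}. C5_omega_factor n) * (\<Prod>m\<in>poles M. trinomial m))
    (euler {1..d} * euler {j\<in>{1..d}. 5 dvd j} * (\<Prod>k\<in>{1..M}. trinomial (5 * k)) :: 'a::comm_ring_1 fps)"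
proof -
  define W where "W = (\<Prod>m\<in>poles M. trinomial m :: 'a fps)"
  define W5 where "W5 = (\<Prod>k\<in>{1..M}. trinomial (5 * k) :: 'a fps)"
  define V where "V = (\<Prod>k\<in>{1..M}. trinomial k :: 'a fps)"
  define R where "R = (\<Prod>k\<in>{1..M}. fps_recip (trinomial k) :: 'a fps)"
  define P where "P = (\<Prod>k\<in>{1..M}. 1 - fps_X ^ k :: 'a fps)"
  define P5 where "P5 = (\<Prod>k\<in>{1..M}. 1 - fps_X ^ (5 * k) :: 'a fps)"
  have P: "eq_upto d P (euler {1..d})"
    unfolding P_def by (rule eq_upto_prod_inj) (use assms in auto)
  have "(*) 5 ` {1..M} \<inter> {..d} = {j\<in>{1..d}. 5 dvd j}"
    using assms by (auto elim!: dvdE)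
  hence P5: "eq_upto d P5 (euler {j\<in>{1..d}. 5 dvd j})"
    unfolding P5_def by (intro eq_upto_prod_inj) (auto simp: inj_on_def)
  have "W5 = (\<Prod>j\<in>(*) 5 ` {1..M}. trinomial j)"
    unfolding W5_def by (subst prod.reindex) (auto simp: inj_on_def)
  hence "W * W5 = (\<Prod>j\<in>{1..5 * M}. trinomial j)"
    unfolding W_def atLeast1AtMost_poles_union(1)
    using atLeast1AtMost_poles_union(2)[of M] by (simp only: prod.union_disjoint finite_poles finite_imageI finite_atLeastAtMost)
  moreover have "eq_upto d (\<Prod>j\<in>{1..5 * M}. trinomial j) V"
    unfolding V_def by (rule eq_upto_prod_subset) (use assms in \<open>auto intro: eq_upto_trinomial\<close>)
  ultimately have W: "eq_upto d (W * W5) V" by simp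
  have "V * R = 1"
    unfolding V_def R_def prod.distrib[symmetric]
    by (rule prod.neutral) (simp add: fps_recip_mult trinomial_nth_0)
  have "(\<Prod>n\<in>{1..M}. C5_omega_factor n) * W = P * P5 * W5 * R * (W * W5)"
    unfolding C5_omega_factor_def prod.distrib P_def[symmetric] P5_def[symmetric] W5_def[symmetric] R_def[symmetric]
    by (simp only: mult_ac)
  also have "eq_upto d \<dots> (euler {1..d} * euler {j\<in>{1..d}. 5 dvd j} * W5 * R * V)"
    by (intro eq_upto_mult P P5 W eq_upto_refl)
  also have "euler {1..d} * euler {j\<in>{1..d}. 5 dvd j} * W5 * R * V =
      euler {1..d} * euler {j\<in>{1..d}. 5 dvd j} * W5 * (V * R)"
    by (simp only: mult_ac)
  finally show ?thesis
    unfolding \<open>V * R = 1\<close> W_def W5_def by simp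
qed

lemma C5_omega_lambert:
  "eq_upto d (\<Prod>n\<in>{1..Suc d}. C5_omega_factor n)
     (\<Sum>n\<in>poles (Suc d). of_int (chi5 n) * fps_X ^ (n - 1) * fps_recip (trinomial n) :: 'a::idom fps)"
proof -
  \<comment> \<open>Then n \<le> M implies 2n + d \<le> 5M, as \<open>numer_denom_cong\<close>
    requires, and n > M implies n - 1 > d, so that both summands vanish up to
    \<open>q\<^sup>d\<close>.\<close>
  define M where "M = Suc d"
  define W where "W = (\<Prod>m\<in>poles M. trinomial m :: 'a fps)"
  define f where "f = (euler {1..d} * euler {j\<in>{1..d}. 5 dvd j} :: 'a fps)"
  have summand: "eq_upto d (f * (of_int (sgnN M n * sgnD M n) * fps_X ^ (expD M n - expN M n) *
      (numer M n * fps_recip (denom M n)) * (\<Prod>m\<in>poles M - {n}. trinomial m)))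
      (of_int (chi5 n) * fps_X ^ (n - 1) * fps_recip (trinomial n) * W)" (is "eq_upto d ?l ?r")
    if n: "n \<in> poles M" for n
  proof -
    have "n > 0" using n by (auto simp: poles_def)
    have "W = trinomial n * (\<Prod>m\<in>poles M - {n}. trinomial m)"
      unfolding W_def by (rule prod.remove) (use n in auto)
    hence W: "fps_recip (trinomial n) * W = (\<Prod>m\<in>poles M - {n}. trinomial m)"
      using fps_recip_mult[OF trinomial_nth_0[OF \<open>n > 0\<close>], where 'a = 'a] by (simp add: mult_ac flip: mult.assoc)
    show ?thesis
    proof (cases "n \<le> M")
      case True
      have "?l = (f * (numer M n * fps_recip (denom M n))) *
          (of_int (chi5 n) * fps_X ^ (n - 1) * (fps_recip (trinomial n) * W))"
        unfolding W sgnN_sgnD_eq[OF n True] expD_minus_expN_eq[OF n True, symmetric] diff_add_inverse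
        by (simp only: mult_ac)
      also have "eq_upto d \<dots> (1 * (of_int (chi5 n) * fps_X ^ (n - 1) * (fps_recip (trinomial n) * W)))"
        unfolding f_def by (intro eq_upto_mult eq_upto_refl numer_denom_cong)
          (use n True in \<open>auto simp: M_def\<close>)
      finally show ?thesis by (simp add: mult.assoc)
    next
      case False
      have X: "eq_upto d (fps_X ^ k) (0 :: 'a fps)" if "d < k" for k
        using that by (auto simp: eq_upto_def fps_X_power_nth)
      have "eq_upto d ?l (f * (of_int (sgnN M n * sgnD M n) * 0 *
          (numer M n * fps_recip (denom M n)) * (\<Prod>m\<in>poles M - {n}. trinomial m)))"
        by (intro eq_upto_mult eq_upto_refl X)
          (use expD_minus_expN_ge[OF n] False in \<open>simp add: M_def\<close>)
      moreover have "eq_upto d ?r (of_int (chi5 n) * 0 * fps_recip (trinomial n) * W)"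
        by (intro eq_upto_mult eq_upto_refl X) (use False in \<open>simp add: M_def\<close>)
      ultimately show ?thesis by (simp add: eq_upto_def)
    qed
  qed
  have "eq_upto d ((\<Prod>n\<in>{1..M}. C5_omega_factor n) * W) (f * (\<Prod>k\<in>{1..M}. trinomial (5 * k)))"
    unfolding W_def f_def by (rule C5_omega_times_poles) (simp add: M_def)
  also have "eq_upto d (f * (\<Prod>k\<in>{1..M}. trinomial (5 * k)))
      (\<Sum>n\<in>poles M. of_int (chi5 n) * fps_X ^ (n - 1) * fps_recip (trinomial n) * W)"
    unfolding prod_trinomial_eq[of M, unfolded M_def, OF zero_less_Suc, folded M_def] sum_distrib_left
    by (intro eq_upto_sum summand)
  finally have "eq_upto d ((\<Prod>n\<in>{1..M}. C5_omega_factor n) * W)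
      ((\<Sum>n\<in>poles M. of_int (chi5 n) * fps_X ^ (n - 1) * fps_recip (trinomial n)) * W)"
    by (simp only: sum_distrib_right)
  moreover have "W $ 0 = 1"
    unfolding W_def fps_prod_nth_0 by (rule prod.neutral) (auto simp: poles_def intro!: trinomial_nth_0)
  ultimately show ?thesis unfolding M_def by (rule eq_upto_cancel)
qed

text \<open>The exponent n - 1 + nj equals d exactly when n(j + 1) = d + 1; hence the divisors of
  \<open>Suc d\<close> rather than of d.\<close>

lemma C5_omega_nth:
  "(\<Prod>n\<in>{1..Suc d}. C5_omega_factor n :: 'a::idom fps) $ d =
     of_int (\<Sum>n\<in>{n\<in>{1..Suc d}. n dvd Suc d}. chi5 n * chi3 (Suc d div n))"
proof -
  have summand: "(of_int (chi5 n) * fps_X ^ (n - 1) * fps_recip (trinomial n) :: 'a fps) $ d =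
      (if n \<in> {n\<in>{1..Suc d}. n dvd Suc d} then of_int (chi5 n * chi3 (Suc d div n)) else 0)"
    if "n > 0" for n
  proof -
    have "(of_int (chi5 n) * fps_X ^ (n - 1) * fps_recip (trinomial n) :: 'a fps) $ d =
        of_int (chi5 n) * (if d < n - 1 then 0 else fps_recip (trinomial n) $ (d - (n - 1)))"
      by (simp add: mult.assoc fps_X_power_mult_nth flip: fps_of_int)
    moreover have "n dvd d - (n - 1) \<longleftrightarrow> n dvd Suc d" "(d - (n - 1)) div n + 1 = Suc d div n"
      if "\<not> d < n - 1"
    proof -
      have "Suc d = (d - (n - 1)) + n" using that \<open>n > 0\<close> by simp
      thus "n dvd d - (n - 1) \<longleftrightarrow> n dvd Suc d" "(d - (n - 1)) div n + 1 = Suc d div n"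
        using \<open>n > 0\<close> by (metis dvd_add_triv_right_iff, metis div_add_self2 not_less0)
    qed
    ultimately show ?thesis
      using \<open>n > 0\<close> by (auto simp: fps_recip_trinomial_nth dest: dvd_imp_le)
  qed
  have "(\<Prod>n\<in>{1..Suc d}. C5_omega_factor n :: 'a fps) $ d =
      (\<Sum>n\<in>poles (Suc d). (of_int (chi5 n) * fps_X ^ (n - 1) * fps_recip (trinomial n) :: 'a fps) $ d)"
    using C5_omega_lambert[of d, where 'a = 'a] by (simp add: eq_upto_def fps_sum_nth)
  also have "\<dots> = (\<Sum>n\<in>poles (Suc d). if n \<in> {n\<in>{1..Suc d}. n dvd Suc d}
      then of_int (chi5 n * chi3 (Suc d div n)) else 0)"
    by (rule sum.cong[OF refl], rule summand) (simp add: poles_def)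
  \<comment> \<open>The multiples of 5 can be added because \<open>chi5\<close> vanishes
    there.\<close>
  also have "\<dots> = (\<Sum>n\<in>{1..5 * Suc d}. if n \<in> {n\<in>{1..Suc d}. n dvd Suc d}
      then of_int (chi5 n * chi3 (Suc d div n)) else 0)"
    by (rule sum.mono_neutral_left) (auto simp: poles_def chi5_def)
  also have "\<dots> = (\<Sum>n\<in>{n\<in>{1..Suc d}. n dvd Suc d}. of_int (chi5 n * chi3 (Suc d div n)))"
    by (rule sum.mono_neutral_cong_right) auto
  finally show ?thesis by (simp only: of_int_sum)
qed

section \<open>Vanishing of the divisor sum by symmetry\<close>

lemma chi5_mult: "chi5 (a * b) = chi5 a * chi5 b"
proof -
  have *: "chi5 n = chi5 (n mod 5)" for n by (simp add: chi5_def)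
  have "chi5 (a * b) = chi5 ((a mod 5) * (b mod 5))"
    using *[of "a * b"] *[of "(a mod 5) * (b mod 5)"] by (simp add: mod_mult_eq)
  moreover have "a mod 5 \<in> {0, 1, 2, 3, 4}" "b mod 5 \<in> {0, 1, 2, 3, 4}" by auto
  ultimately show ?thesis
    unfolding *[of a] *[of b] by (elim insertE emptyE) (simp_all add: chi5_def)
qed

lemma chi3_mult: "chi3 (a * b) = chi3 a * chi3 b"
proof -
  have *: "chi3 n = chi3 (n mod 3)" for n by (simp add: chi3_def)
  have "chi3 (a * b) = chi3 ((a mod 3) * (b mod 3))"
    using *[of "a * b"] *[of "(a mod 3) * (b mod 3)"] by (simp add: mod_mult_eq)
  moreover have "a mod 3 \<in> {0, 1, 2}" "b mod 3 \<in> {0, 1, 2}" by auto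
  ultimately show ?thesis
    unfolding *[of a] *[of b] by (elim insertE emptyE) (simp_all add: chi3_def)
qed

text \<open>The terms at n and N/n lie in {-1, 0, 1} and have product
  \<open>chi3 N * chi5 N = -1\<close>, so they are opposite; the sum equals its own
  negative.\<close>

lemma chi_divisor_sum_eq_0:
  assumes "chi3 N * chi5 N = -1" "N > 0"
  shows "(\<Sum>n\<in>{n\<in>{1..N}. n dvd N}. chi5 n * chi3 (N div n)) = 0"
proof -
  let ?D = "{n\<in>{1..N}. n dvd N}"
  have flip: "chi5 (N div n) * chi3 n = - (chi5 n * chi3 (N div n))" if "n dvd N" for n
  proof -
    have N: "n * (N div n) = N" using that by simp
    have "chi5 n * chi5 (N div n) * (chi3 n * chi3 (N div n)) = -1"
      using assms(1) unfolding chi5_mult[symmetric] chi3_mult[symmetric] N by (simp add: mult.commute)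
    moreover have "chi5 k \<in> {-1, 0, 1}" "chi3 k \<in> {-1, 0, 1}" for k
      by (auto simp: chi5_def chi3_def)
    from this[of n] this[of "N div n"] have "chi5 n \<in> {-1, 0, 1}" "chi3 n \<in> {-1, 0, 1}"
      "chi5 (N div n) \<in> {-1, 0, 1}" "chi3 (N div n) \<in> {-1, 0, 1}" by blast+
    ultimately show ?thesis by (elim insertE emptyE) simp_all
  qed
  have "(\<Sum>n\<in>?D. chi5 n * chi3 (N div n)) = (\<Sum>n\<in>?D. chi5 (N div n) * chi3 (N div (N div n)))"
    by (rule sum.reindex_bij_witness[of _ "\<lambda>n. N div n" "\<lambda>n. N div n"])
       (use assms(2) in \<open>auto simp: div_dvd_iff_mult dvd_imp_le Suc_le_eq div_greater_zero_iff elim!: dvdE\<close>)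
  also have "\<dots> = (\<Sum>n\<in>?D. - (chi5 n * chi3 (N div n)))"
  proof (rule sum.cong)
    fix n assume "n \<in> ?D"
    moreover from this have "N div (N div n) = n" using assms(2) by (auto elim!: dvdE)
    ultimately show "chi5 (N div n) * chi3 (N div (N div n)) = - (chi5 n * chi3 (N div n))"
      using flip[of n] by simp
  qed simp
  finally show ?thesis by (simp add: sum_negf)
qed

section \<open>Specialization at \<open>\<zeta> = 1\<close> and reduction modulo \<open>\<Phi>\<^sub>3\<close>\<close>

lemma laurent_at_one_add: "laurent_at_one (p + q) = laurent_at_one p + laurent_at_one q"
  unfolding laurent_at_one_def by (rule setsum_keys_plus_distrib) auto

lemma laurent_at_one_single: "laurent_at_one (Poly_Mapping.single k c) = c"
  by (simp add: laurent_at_one_def)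

lemma laurent_at_one_0 [simp]: "laurent_at_one 0 = 0"
  by (simp add: laurent_at_one_def)

lemma laurent_at_one_1 [simp]: "laurent_at_one 1 = 1"
  by (metis laurent_at_one_single single_one)

lemma laurent_at_one_diff: "laurent_at_one (p - q) = laurent_at_one p - laurent_at_one q"
  by (metis add_diff_cancel_right' diff_add_cancel laurent_at_one_add)

lemma laurent_at_one_sum: "laurent_at_one (\<Sum>x\<in>A. f x) = (\<Sum>x\<in>A. laurent_at_one (f x))"
  by (induction A rule: infinite_finite_induct) (simp_all add: laurent_at_one_add)

text \<open>Integer Laurent polynomials form the free abelian group on the exponents, so induction
  in each factor reduces the claim to monomials.\<close>

lemma laurent_at_one_mult: "laurent_at_one (p * q) = laurent_at_one p * laurent_at_one q"
proof -
  have *: "laurent_at_one (frag_of k * q) = laurent_at_one q" for k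
    using subset_UNIV[of "Poly_Mapping.keys q"]
    by (induction q rule: frag_induction)
       (simp_all add: right_diff_distrib laurent_at_one_diff mult_single laurent_at_one_single)
  show ?thesis
    using subset_UNIV[of "Poly_Mapping.keys p"]
    by (induction p rule: frag_induction)
       (simp_all add: left_diff_distrib laurent_at_one_diff * laurent_at_one_single)
qed

lemma set_zeta_one_1 [simp]: "set_zeta_one 1 = 1"
  by (rule fps_ext) (simp add: set_zeta_one_def)

lemma set_zeta_one_diff: "set_zeta_one (f - g) = set_zeta_one f - set_zeta_one g"
  by (rule fps_ext) (simp add: set_zeta_one_def laurent_at_one_diff)

lemma set_zeta_one_mult: "set_zeta_one (f * g) = set_zeta_one f * set_zeta_one g"
  by (rule fps_ext)
     (simp add: set_zeta_one_def fps_mult_nth laurent_at_one_sum laurent_at_one_mult)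

lemma set_zeta_one_prod: "set_zeta_one (\<Prod>x\<in>A. f x) = (\<Prod>x\<in>A. set_zeta_one (f x))"
  by (induction A rule: infinite_finite_induct) (simp_all add: set_zeta_one_mult)

lemma set_zeta_one_X_power: "set_zeta_one (fps_X ^ n) = fps_X ^ n"
  by (rule fps_ext) (simp add: set_zeta_one_def fps_X_power_nth)

lemma set_zeta_one_recip:
  assumes "f $ 0 = 1"
  shows "set_zeta_one (fps_recip f) = fps_recip (set_zeta_one f)"
proof (rule fps_recip_unique)
  show "set_zeta_one f $ 0 = 1"
    using assms by (simp add: set_zeta_one_def)
  show "set_zeta_one f * set_zeta_one (fps_recip f) = 1"
    using fps_recip_mult[OF assms] by (simp flip: set_zeta_one_mult)
qed

lemma set_zeta_one_const: "set_zeta_one (fps_const c) = fps_const (laurent_at_one c)"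
  by (rule fps_ext) (simp add: set_zeta_one_def)

lemma set_zeta_one_lin: "set_zeta_one (lin k n) = 1 - fps_X ^ n"
  by (simp add: lin_def set_zeta_one_diff set_zeta_one_mult set_zeta_one_X_power
      set_zeta_one_const zeta_pow_def laurent_at_one_single)

lemma lin_pm_nth_0: "n > 0 \<Longrightarrow> lin_pm k n $ 0 = 1"
  by (simp add: lin_pm_def lin_def)

text \<open>At \<zeta> = 1 the five factors in \<open>q\<^sup>5\<^sup>n\<close> coincide, and
  \<open>1 - q\<^sup>n\<close> cancels one of the two equal factors of the denominator.\<close>

lemma set_zeta_one_C5_factor:
  assumes "n > 0"
  shows "set_zeta_one (C5_factor n) = core5_factor n"
proof -
  let ?a = "1 - fps_X ^ n :: int fps" and ?b = "1 - fps_X ^ (5 * n) :: int fps"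
  have a: "?a $ 0 = 1" using assms by simp
  have swap: "?a * ?a * (fps_recip ?a * fps_recip ?a) = (?a * fps_recip ?a) * (?a * fps_recip ?a)"
    by (simp only: mult_ac)
  have r: "fps_recip (?a * ?a) = fps_recip ?a * fps_recip ?a"
    by (rule fps_recip_unique[symmetric])
       (use a fps_recip_mult[OF a] swap in \<open>simp_all\<close>)
  have pm: "set_zeta_one (lin_pm k n) = (1 - fps_X ^ n) * (1 - fps_X ^ n)" for k n
    by (simp only: lin_pm_def set_zeta_one_mult set_zeta_one_lin)
  have "set_zeta_one (C5_factor n) = ?a * ?b * (?b * ?b) * (?b * ?b) * fps_recip (?a * ?a)"
    using assms
    by (simp only: C5_factor_def set_zeta_one_mult set_zeta_one_recip lin_pm_nth_0 pm
        set_zeta_one_diff set_zeta_one_X_power set_zeta_one_1)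
  also have "\<dots> = (?a * fps_recip ?a) * ?b ^ 5 * fps_recip ?a"
    unfolding r by (simp add: power_numeral_reduce mult_ac)
  finally show ?thesis
    by (simp add: fps_recip_mult[OF a] core5_factor_def)
qed

text \<open>The factor of index \<open>Suc i\<close> is 1 up to \<open>q\<^sup>i\<close>, so factors
  beyond the finite range leave the coefficient unchanged.\<close>

lemma prodinf_fps_nth:
  fixes f :: "nat \<Rightarrow> 'a::idom fps"
  assumes "\<And>i. unit_upto i (f (Suc i))"
  shows "prodinf (\<lambda>i. f (Suc i)) $ m = (\<Prod>n\<in>{1..Suc m}. f n) $ m"
proof -
  have "(\<lambda>i. f (Suc i)) has_prod Abs_fps (\<lambda>m. (\<Prod>i\<le>m. f (Suc i)) $ m)"
    using assms by (intro fps_has_prodI) (auto simp: unit_upto_def)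
  hence "prodinf (\<lambda>i. f (Suc i)) = Abs_fps (\<lambda>m. (\<Prod>i\<le>m. f (Suc i)) $ m)"
    by (rule has_prod_unique[symmetric])
  moreover have "(\<Prod>n\<in>{1..Suc m}. f n) = (\<Prod>i\<le>m. f (Suc i))"
    unfolding One_nat_def prod.atLeast1_atMost_eq lessThan_Suc_atMost ..
  ultimately show ?thesis by simp
qed

lemma C5_nth: "C5 $ m = (\<Prod>n\<in>{1..Suc m}. C5_factor n) $ m"
  unfolding C5_def C5_factor_def
  by (intro prodinf_fps_nth unit_upto_mult unit_upto_recip unit_upto_X unit_upto_lin_pm) auto

lemma core5_nth: "core5 m = (\<Prod>n\<in>{1..Suc m}. core5_factor n) $ m"
  unfolding core5_def core5_factor_def
  by (intro prodinf_fps_nth unit_upto_mult unit_upto_power unit_upto_recip unit_upto_X) auto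

lemma set_zeta_one_C5: "set_zeta_one C5 = Abs_fps core5"
proof (rule fps_ext)
  fix m
  have "set_zeta_one C5 $ m = set_zeta_one (\<Prod>n\<in>{1..Suc m}. C5_factor n) $ m"
    by (simp only: set_zeta_one_def fps_nth_Abs_fps C5_nth)
  also have "\<dots> = (\<Prod>n\<in>{1..Suc m}. core5_factor n) $ m"
    unfolding set_zeta_one_prod by (intro arg_cong[of _ _ "\<lambda>f. f $ m"] prod.cong)
      (auto simp: set_zeta_one_C5_factor)
  finally show "set_zeta_one C5 $ m = Abs_fps core5 $ m"
    by (simp add: core5_nth)
qed

section \<open>Reduction modulo the third cyclotomic polynomial\<close>

definition Phi3 :: int_laurent where "Phi3 = 1 + zeta_pow 1 + zeta_pow 2"

lemma zeta_pow_add: "zeta_pow (j + k) = zeta_pow j * zeta_pow k"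
  by (simp add: zeta_pow_def mult_single)

lemma zeta_pow_0 [simp]: "zeta_pow 0 = 1"
  by (simp add: zeta_pow_def)

lemma laurent_of_poly_cyclotomic_3: "laurent_of_poly (cyclotomic 3) = Phi3"
  using zeta_pow_add[of 1 1]
  by (simp add: cyclotomic_3 laurent_of_poly_def map_poly_pCons Phi3_def algebra_simps)

text \<open>\<open>Phi3\<close> divides \<open>\<zeta>\<^sup>3 - 1\<close>, so exponents may be
  reduced modulo 3, and k and -k reduce to 1 and 2 in some order.\<close>

lemma Phi3_dvd_zeta_pow_pm:
  assumes "\<not> 3 dvd k"
  shows "Phi3 dvd 1 + zeta_pow k + zeta_pow (- k)"
proof -
  have "Phi3 * (zeta_pow 1 - 1) = zeta_pow 3 - 1"
    using zeta_pow_add[of 1 1] zeta_pow_add[of 2 1] by (simp add: Phi3_def algebra_simps)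
  hence d3: "Phi3 dvd zeta_pow 3 - 1" by (metis dvd_triv_left)
  have dn: "Phi3 dvd zeta_pow (3 * int n) - 1" for n
  proof (induction n)
    case (Suc n)
    have "zeta_pow (3 * int (Suc n)) - 1 = zeta_pow 3 * (zeta_pow (3 * int n) - 1) + (zeta_pow 3 - 1)"
      using zeta_pow_add[of 3 "3 * int n"] by (simp add: algebra_simps)
    thus ?case using Suc d3 by (metis dvd_add dvd_mult)
  qed simp
  have dj: "Phi3 dvd zeta_pow (3 * j) - 1" for j
  proof (cases "j \<ge> 0")
    case True
    thus ?thesis using dn[of "nat j"] by simp
  next
    case False
    have "zeta_pow (3 * j) - 1 = - zeta_pow (3 * j) * (zeta_pow (3 * int (nat (- j))) - 1)"
      using zeta_pow_add[of "3 * j" "- (3 * j)"] False by (simp add: algebra_simps)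
    thus ?thesis using dn[of "nat (-j)"] by simp
  qed
  have red: "Phi3 dvd zeta_pow k - zeta_pow (k mod 3)" for k
  proof -
    have "zeta_pow k - zeta_pow (k mod 3) = zeta_pow (k mod 3) * (zeta_pow (3 * (k div 3)) - 1)"
      using zeta_pow_add[of "k mod 3" "3 * (k div 3)"] by (simp add: algebra_simps)
    thus ?thesis using dj[of "k div 3"] by simp
  qed
  have "k mod 3 = 1 \<and> (- k) mod 3 = 2 \<or> k mod 3 = 2 \<and> (- k) mod 3 = 1"
    using assms by presburger
  hence P: "1 + zeta_pow (k mod 3) + zeta_pow ((- k) mod 3) = Phi3"
    by (auto simp: Phi3_def)
  have "1 + zeta_pow k + zeta_pow (- k) =
      (1 + zeta_pow (k mod 3) + zeta_pow ((- k) mod 3)) +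
      (zeta_pow k - zeta_pow (k mod 3)) + (zeta_pow (- k) - zeta_pow ((- k) mod 3))"
    by simp
  note this[unfolded P]
  thus ?thesis using red[of k] red[of "- k"] by (metis dvd_add dvd_refl)
qed

text \<open>The difference is
  \<open>- q\<^sup>n (1 + \<zeta>\<^sup>k + \<zeta>\<^sup>-\<^sup>k)\<close>. Divisibility by a
  constant series passes to every coefficient in q.\<close>

lemma lin_pm_cong:
  assumes "\<not> 3 dvd k"
  shows "fps_const Phi3 dvd lin_pm k n - trinomial n"
proof -
  have z: "fps_const (zeta_pow k) * fps_const (zeta_pow (- k)) = 1"
    using zeta_pow_add[of k "- k"] by simp
  have expand: "(1 - a * x) * (1 - b * x) - (1 + x + x * x) = - (x * (1 + a + b))"
    if "a * b = 1" for a b x :: "int_laurent fps"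
  proof -
    have "(1 - a * x) * (1 - b * x) = 1 - a * x - b * x + (a * b) * (x * x)"
      by (simp only: algebra_simps mult_1_left)
    thus ?thesis unfolding that by (simp add: algebra_simps)
  qed
  have "lin_pm k n - trinomial n = - (fps_X ^ n * fps_const (1 + zeta_pow k + zeta_pow (- k)))"
    unfolding lin_pm_def lin_def trinomial_def mult_2 power_add fps_const_add[symmetric] fps_const_1_eq_1
    using z by (rule expand)
  moreover have "fps_const Phi3 dvd fps_const (1 + zeta_pow k + zeta_pow (- k))"
    using Phi3_dvd_zeta_pow_pm[OF assms] by (metis dvd_def fps_const_mult)
  ultimately show ?thesis by simp
qed

lemma dvd_diff_mult:
  fixes c :: "'a::comm_ring_1"
  assumes "c dvd f - f'" "c dvd g - g'"
  shows "c dvd f * g - f' * g'"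
proof -
  have "f * g - f' * g' = (f - f') * g + f' * (g - g')" by (simp add: algebra_simps)
  thus ?thesis using assms by simp
qed

lemma dvd_diff_recip:
  assumes "f $ 0 = 1" "g $ 0 = 1" "c dvd f - g"
  shows "c dvd fps_recip f - fps_recip g"
proof -
  have "(f - g) * (fps_recip f * fps_recip g) = (f * fps_recip f) * fps_recip g - (g * fps_recip g) * fps_recip f"
    by (simp only: algebra_simps mult_1_left)
  hence "fps_recip f - fps_recip g = - ((f - g) * (fps_recip f * fps_recip g))"
    using assms by (simp add: fps_recip_mult)
  thus ?thesis using assms(3) by simp
qed

lemma dvd_diff_prod:
  fixes c :: "'a::comm_ring_1"
  assumes "\<And>x. x \<in> A \<Longrightarrow> c dvd f x - g x"
  shows "c dvd (\<Prod>x\<in>A. f x) - (\<Prod>x\<in>A. g x)"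
  using assms by (induction A rule: infinite_finite_induct) (auto intro: dvd_diff_mult)

lemma Phi3_dvd_C5_nth_diff:
  "Phi3 dvd C5 $ m - (\<Prod>n\<in>{1..Suc m}. C5_omega_factor n) $ m"
proof -
  have "fps_const Phi3 dvd C5_factor n - C5_omega_factor n" if "n > 0" for n
    unfolding C5_factor_def C5_omega_factor_def
    by (intro dvd_diff_mult dvd_diff_recip lin_pm_cong)
       (use that in \<open>simp_all add: lin_pm_nth_0 trinomial_nth_0\<close>)
  hence "fps_const Phi3 dvd (\<Prod>n\<in>{1..Suc m}. C5_factor n) - (\<Prod>n\<in>{1..Suc m}. C5_omega_factor n)"
    by (intro dvd_diff_prod) auto
  then obtain h where
    "(\<Prod>n\<in>{1..Suc m}. C5_factor n) - (\<Prod>n\<in>{1..Suc m}. C5_omega_factor n) = fps_const Phi3 * h"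
    by (rule dvdE)
  hence "C5 $ m - (\<Prod>n\<in>{1..Suc m}. C5_omega_factor n) $ m = Phi3 * h $ m"
    unfolding C5_nth by (metis fps_mult_left_const_nth fps_sub_nth)
  thus ?thesis by simp
qed

theorem theorem1p2:
  shows "is_crank_gf C5 core5 \<and> (\<forall>\<beta>\<in>{6, 10, 12, 13}. explains C5 core5 15 \<beta> 3)"
proof -
  have explains: "explains C5 core5 15 \<beta> 3" if \<beta>: "\<beta> \<in> {6, 10, 12, 13}" for \<beta>
  proof -
    have dvd: "Phi3 dvd C5 $ (15 * n + \<beta>)" for n
    proof -
      \<comment> \<open>The shift by one turns \<beta> = 6, 10, 12, 13 into the residues 7, 11, 13,
        14 modulo 15, where the two characters have opposite signs.\<close>
      let ?N = "Suc (15 * n + \<beta>)"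
      have "?N mod 3 = Suc \<beta> mod 3" "?N mod 5 = Suc \<beta> mod 5"
        by presburger+
      hence "chi3 ?N * chi5 ?N = -1"
        using \<beta> by (elim insertE emptyE) (simp_all only: chi3_def chi5_def, simp_all)
      hence "(\<Prod>n\<in>{1..?N}. C5_omega_factor n :: int_laurent fps) $ (15 * n + \<beta>) = 0"
        unfolding C5_omega_nth by (subst chi_divisor_sum_eq_0) simp_all
      thus ?thesis
        using Phi3_dvd_C5_nth_diff[of "15 * n + \<beta>"] by simp
    qed
    \<comment> \<open>The congruence is the divisibility read at \<zeta> = 1, where
      \<open>Phi3\<close> takes the value 3.\<close>
    have "[core5 (15 * n + \<beta>) = 0] (mod 3)" for n
    proof -
      obtain c where c: "C5 $ (15 * n + \<beta>) = Phi3 * c"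
        using dvd[of n] by (rule dvdE)
      have "core5 (15 * n + \<beta>) = set_zeta_one C5 $ (15 * n + \<beta>)"
        by (simp add: set_zeta_one_C5)
      also have "\<dots> = 3 * laurent_at_one c"
        by (simp add: set_zeta_one_def c laurent_at_one_mult Phi3_def laurent_at_one_add
            zeta_pow_def laurent_at_one_single)
      finally show ?thesis by (simp add: cong_0_iff)
    qed
    thus ?thesis
      using \<beta> dvd by (auto simp: explains_def set_zeta_one_C5 laurent_of_poly_cyclotomic_3)
  qed
  thus ?thesis unfolding is_crank_gf_def by blast
qed

end
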